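(* Let $k>0$ and $l\neq 0$ be coprime integers. (1) Suppose $l>0$. Then $\mathcal{O}(S^2_{pq}(k,l^+))$ is the $*$-subalgebra of $\mathcal{O}(S^3_{pq\theta})$ generated by $A=1-aa^*$, $B=1-bb^*$ and $C_+=a^l b^{*k}$, and these satisfy the relations $$A^*=A,\quad B^*=B,\quad AB=BA=0,\quad AC_+=p^l C_+A,\quad BC_+=q^{-k}C_+B,$$ $$C_+^*C_+=\prod_{i=1}^{l}(1-p^iA)\ \prod_{j=1}^{k}(1-q^{j-k}B),\qquad C_+C_+^*=\prod_{i=1}^{l}(1-p^{i-l}A)\ \prod_{j=1}^{k}(1-q^{j}B).$$ Since $AB=0$, the last two relations can alternatively be expressed as $$C_+^*C_+=\prod_{i=1}^{l}(1-p^iA)+\prod_{j=1}^{k}(1-q^{j-k}B)-1,\qquad C_+C_+^*=\prod_{i=1}^{l}(1-p^{i-l}A)+\prod_{j=1}^{k}(1-q^{j}B)-1.$$ (2) Suppose $l<0$. Then $\mathcal{O}(S^2_{pq}(k,l^-))$ is the $*$-subalgebra of $\mathcal{O}(S^3_{pq\theta})$ generated by $A=1-aa^*$, $B=1-bb^*$ and $C_-=a^{*|l|}b^{*k}$, and these satisfy the relations $$A^*=A,\quad B^*=B,\quad AB=BA=0,\quad AC_-=p^l C_-A,\quad BC_-=q^{-k}C_-B,$$ $$C_-^*C_-=\prod_{i=1}^{|l|}(1-p^{i+l}A)\ \prod_{j=1}^{k}(1-q^{j-k}B),\qquad C_-C_-^*=\prod_{i=1}^{|l|}(1-p^{i}A)\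 \prod_{j=1}^{k}(1-q^{j}B).$$ Since $AB=0$, the last two relations can alternatively be expressed as $$C_-^*C_-=\prod_{i=1}^{|l|}(1-p^{i+l}A)+\prod_{j=1}^{k}(1-q^{j-k}B)-1,\qquad C_-C_-^*=\prod_{i=1}^{|l|}(1-p^{i}A)+\prod_{j=1}^{k}(1-q^{j}B)-1.$$
   Context: Fix real numbers $0<p,q,\theta<1$ with $\theta$ irrational. $\mathcal{O}(S^3_{pq\theta})$ (coordinate algebra of the Heegaard quantum 3-sphere) is the unital complex $*$-algebra generated by $a,b$ subject to $$ab=e^{2\pi i\theta}ba,\quad ab^*=e^{-2\pi i\theta}b^*a,\quad a^*a-paa^*=1-p,\quad b^*b-qbb^*=1-q,\quad (1-aa^* )(1-bb^* )=0.$$ $\mathcal{O}(U(1))=\mathbb{C}[u,u^*]$ with $uu^*=u^*u=1$ is the Hopf $*$-algebra with $\Delta(u)=u\otimes u$, $\epsilon(u)=1$, $S(u)=u^*$. For coprime integers $k,l$ with $k>0$, $l\ne 0$, the weighted coaction is the $*$-algebra map $\phi_{k,l}:\mathcal{O}(S^3_{pq\theta})\to\mathcal{O}(S^3_{pq\theta})\otimes\mathcal{O}(U(1))$ with $a\mapsto a\otimes u^k$, $b\mapsto b\otimes u^l$ (where $u^{l}=(u^{*})^{|l|}$ for $l<0$). The coordinate algebra of the quantum weighted Heegaard sphere is the fixed point (coinvariant) algebra $\{x\in\mathcal{O}(S^3_{pq\theta}):\phi_{k,l}(x)=x\otimes 1\}$; it is denoted $\mathcal{O}(S^2_{pq}(k,l^+))$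 if $l>0$ and $\mathcal{O}(S^2_{pq}(k,l^-))$ if $l<0$. *)

theory Defs
  imports
    Complex_Main
    "HOL-Algebra.QuotRing"
    "HOL-Algebra.Module"
    "HOL-Algebra.Subrings"
    "HOL-Library.Poly_Mapping"
begin

section \<open>Complex star-algebras\<close>

definition complex_ring :: "complex ring" where
  "complex_ring = \<lparr>carrier = UNIV, mult = (*), one = 1, zero = 0, add = (+)\<rparr>"

record 'a star_algebra = "(complex, 'a) module" +
  star :: "'a \<Rightarrow> 'a"

definition star_alg_hom ::
  "('a, 'y) star_algebra_scheme \<Rightarrow> ('b, 'z) star_algebra_scheme \<Rightarrow> ('a \<Rightarrow> 'b) set" where
  "star_alg_hom S T =
    {f \<in> ring_hom S T. \<forall>x\<in>carrier S.
       (\<forall>c. f (c \<odot>\<^bsub>S\<^esub> x) = c \<odot>\<^bsub>T\<^esub> f x) \<and> f (star S x) = star T (f x)}"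

definition star_subalgebra :: "'a set \<Rightarrow> ('a, 'z) star_algebra_scheme \<Rightarrow> bool" where
  "star_subalgebra H S \<longleftrightarrow>
    subring H S \<and> submodule H complex_ring S \<and> (\<forall>x\<in>H. star S x \<in> H)"

definition generated_star_subalgebra :: "('a, 'z) star_algebra_scheme \<Rightarrow> 'a set \<Rightarrow> 'a set" where
  "generated_star_subalgebra S X = \<Inter>{H. star_subalgebra H S \<and> X \<subseteq> H}"

text \<open>In a noncommutative ring the order of the factors matters;
  this is \<open>f 1 \<otimes> f 2 \<otimes> \<dots> \<otimes> f n\<close>.\<close>

definition ordered_prod :: "('a, 'z) monoid_scheme \<Rightarrow> (nat \<Rightarrow> 'a) \<Rightarrow> nat \<Rightarrow> 'a" where
  "ordered_prod S f n = foldr (mult S) (map f [1..<Suc n]) \<one>\<^bsub>S\<^esub>"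

text \<open>The quotient by an ideal \<open>I\<close> that is closed under the involution.
  Every ideal of a unital algebra is closed under scalar multiplication.\<close>

definition quot_star_algebra ::
  "('a, 'z) star_algebra_scheme \<Rightarrow> 'a set \<Rightarrow> 'a set star_algebra" where
  "quot_star_algebra S I =
    \<lparr>carrier = carrier (S Quot I), mult = mult (S Quot I), one = one (S Quot I),
     zero = zero (S Quot I), add = add (S Quot I),
     smult = (\<lambda>c X. \<Union>x\<in>X. I +>\<^bsub>S\<^esub> (c \<odot>\<^bsub>S\<^esub> x)),
     star = (\<lambda>X. \<Union>x\<in>X. I +>\<^bsub>S\<^esub> star S x)\<rparr>"

section \<open>Star-algebras given by generators and relations\<close>

text \<open>The monoid algebra \<open>\<complex>[M]\<close>; \<open>\<sigma>\<close> is an anti-multiplicative involution of the monoid \<open>M\<close>, extended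
  conjugate-linearly.\<close>

definition monoid_star_algebra ::
  "('m, 'z) monoid_scheme \<Rightarrow> ('m \<Rightarrow> 'm) \<Rightarrow> ('m \<Rightarrow>\<^sub>0 complex) star_algebra" where
  "monoid_star_algebra M \<sigma> =
    \<lparr>carrier = {f. Poly_Mapping.keys f \<subseteq> carrier M},
     mult = (\<lambda>f g. \<Sum>s\<in>Poly_Mapping.keys f. \<Sum>t\<in>Poly_Mapping.keys g.
       Poly_Mapping.single (s \<otimes>\<^bsub>M\<^esub> t) (Poly_Mapping.lookup f s * Poly_Mapping.lookup g t)),
     one = Poly_Mapping.single \<one>\<^bsub>M\<^esub> 1,
     zero = 0,
     add = (+),
     smult = (\<lambda>c. Poly_Mapping.map ((*) c)),
     star = (\<lambda>f. \<Sum>s\<in>Poly_Mapping.keys f.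
       Poly_Mapping.single (\<sigma> s) (cnj (Poly_Mapping.lookup f s)))\<rparr>"

text \<open>Words in letters \<open>(g, False)\<close> and \<open>(g, True)\<close>, standing for a generator \<open>g\<close> and for its
  adjoint.\<close>

definition word_monoid :: "('g \<times> bool) list monoid" where
  "word_monoid = \<lparr>carrier = UNIV, mult = (@), one = []\<rparr>"

definition word_star :: "('g \<times> bool) list \<Rightarrow> ('g \<times> bool) list" where
  "word_star w = rev (map (apsnd Not) w)"

definition free_star_algebra :: "(('g \<times> bool) list \<Rightarrow>\<^sub>0 complex) star_algebra" where
  "free_star_algebra = monoid_star_algebra word_monoid word_star"

definition free_gen :: "'g \<Rightarrow> (('g \<times> bool) list \<Rightarrow>\<^sub>0 complex)" where
  "free_gen g = Poly_Mapping.single [(g, False)] 1"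

definition relation_ideal ::
  "(('g \<times> bool) list \<Rightarrow>\<^sub>0 complex) set \<Rightarrow> (('g \<times> bool) list \<Rightarrow>\<^sub>0 complex) set" where
  "relation_ideal R = Idl\<^bsub>free_star_algebra\<^esub> (R \<union> star free_star_algebra ` R)"

definition presented_star_algebra ::
  "(('g \<times> bool) list \<Rightarrow>\<^sub>0 complex) set \<Rightarrow> (('g \<times> bool) list \<Rightarrow>\<^sub>0 complex) set star_algebra" where
  "presented_star_algebra R = quot_star_algebra free_star_algebra (relation_ideal R)"

definition presented_gen ::
  "(('g \<times> bool) list \<Rightarrow>\<^sub>0 complex) set \<Rightarrow> 'g \<Rightarrow> (('g \<times> bool) list \<Rightarrow>\<^sub>0 complex) set" where
  "presented_gen R g = relation_ideal R +>\<^bsub>free_star_algebra\<^esub> free_gen g"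

section \<open>The algebraic tensor product of star-algebras\<close>

text \<open>As a vector space, \<open>S \<otimes> T\<close> is the free vector space on \<open>carrier S \<times> carrier T\<close> modulo the span
  of the bilinearity relations. Multiplication and involution are induced by
  \<open>(x, y)(x', y') = (xx', yy')\<close> and \<open>(x, y)\<^sup>* = (x\<^sup>*, y\<^sup>*)\<close>. The span is a two-sided ideal closed under the
  involution: multiplying a bilinearity relation by a pair \<open>(z, w)\<close>, or applying the involution to
  it, gives a bilinearity relation again.\<close>

definition free_tensor ::
  "('a, 'y) star_algebra_scheme \<Rightarrow> ('b, 'z) star_algebra_scheme \<Rightarrow>
   ('a \<times> 'b \<Rightarrow>\<^sub>0 complex) star_algebra" where
  "free_tensor S T = monoid_star_algebra (S \<times>\<times> T) (map_prod (star S) (star T))"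

definition bilinear_relations ::
  "('a, 'y) star_algebra_scheme \<Rightarrow> ('b, 'z) star_algebra_scheme \<Rightarrow> ('a \<times> 'b \<Rightarrow>\<^sub>0 complex) set" where
  "bilinear_relations S T =
    (let \<delta> = (\<lambda>x y. Poly_Mapping.single (x, y) (1::complex)) in
      {\<delta> (x \<oplus>\<^bsub>S\<^esub> x') y - \<delta> x y - \<delta> x' y | x x' y.
         x \<in> carrier S \<and> x' \<in> carrier S \<and> y \<in> carrier T} \<union>
      {\<delta> x (y \<oplus>\<^bsub>T\<^esub> y') - \<delta> x y - \<delta> x y' | x y y'.
         x \<in> carrier S \<and> y \<in> carrier T \<and> y' \<in> carrier T} \<union>
      {\<delta> (c \<odot>\<^bsub>S\<^esub> x) y - Poly_Mapping.single (x, y) c | c x y.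
         x \<in> carrier S \<and> y \<in> carrier T} \<union>
      {\<delta> x (c \<odot>\<^bsub>T\<^esub> y) - Poly_Mapping.single (x, y) c | c x y.
         x \<in> carrier S \<and> y \<in> carrier T})"

definition bilinear_span ::
  "('a, 'y) star_algebra_scheme \<Rightarrow> ('b, 'z) star_algebra_scheme \<Rightarrow> ('a \<times> 'b \<Rightarrow>\<^sub>0 complex) set" where
  "bilinear_span S T =
    \<Inter>{N. submodule N complex_ring (free_tensor S T) \<and> bilinear_relations S T \<subseteq> N}"

definition tensor_algebra ::
  "('a, 'y) star_algebra_scheme \<Rightarrow> ('b, 'z) star_algebra_scheme \<Rightarrow>
   ('a \<times> 'b \<Rightarrow>\<^sub>0 complex) set star_algebra" where
  "tensor_algebra S T = quot_star_algebra (free_tensor S T) (bilinear_span S T)"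

definition pure_tensor ::
  "('a, 'y) star_algebra_scheme \<Rightarrow> ('b, 'z) star_algebra_scheme \<Rightarrow> 'a \<Rightarrow> 'b \<Rightarrow>
   ('a \<times> 'b \<Rightarrow>\<^sub>0 complex) set" where
  "pure_tensor S T x y = bilinear_span S T +>\<^bsub>free_tensor S T\<^esub> Poly_Mapping.single (x, y) 1"

section \<open>The Heegaard quantum 3-sphere\<close>

datatype gen = GenA | GenB

definition S3_relations ::
  "real \<Rightarrow> real \<Rightarrow> real \<Rightarrow> ((gen \<times> bool) list \<Rightarrow>\<^sub>0 complex) set" where
  "S3_relations p q \<theta> =
    (let F = free_star_algebra; a = free_gen GenA; b = free_gen GenB in
      {(a \<otimes>\<^bsub>F\<^esub> b) \<ominus>\<^bsub>F\<^esub> (exp (2 * of_real pi * \<i> * of_real \<theta>) \<odot>\<^bsub>F\<^esub> (b \<otimes>\<^bsub>F\<^esub> a)),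
       (a \<otimes>\<^bsub>F\<^esub> star F b) \<ominus>\<^bsub>F\<^esub> (exp (- 2 * of_real pi * \<i> * of_real \<theta>) \<odot>\<^bsub>F\<^esub> (star F b \<otimes>\<^bsub>F\<^esub> a)),
       ((star F a \<otimes>\<^bsub>F\<^esub> a) \<ominus>\<^bsub>F\<^esub> (of_real p \<odot>\<^bsub>F\<^esub> (a \<otimes>\<^bsub>F\<^esub> star F a)))
         \<ominus>\<^bsub>F\<^esub> (of_real (1 - p) \<odot>\<^bsub>F\<^esub> \<one>\<^bsub>F\<^esub>),
       ((star F b \<otimes>\<^bsub>F\<^esub> b) \<ominus>\<^bsub>F\<^esub> (of_real q \<odot>\<^bsub>F\<^esub> (b \<otimes>\<^bsub>F\<^esub> star F b)))
         \<ominus>\<^bsub>F\<^esub> (of_real (1 - q) \<odot>\<^bsub>F\<^esub> \<one>\<^bsub>F\<^esub>),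
       (\<one>\<^bsub>F\<^esub> \<ominus>\<^bsub>F\<^esub> (a \<otimes>\<^bsub>F\<^esub> star F a)) \<otimes>\<^bsub>F\<^esub> (\<one>\<^bsub>F\<^esub> \<ominus>\<^bsub>F\<^esub> (b \<otimes>\<^bsub>F\<^esub> star F b))})"

definition OS3 ::
  "real \<Rightarrow> real \<Rightarrow> real \<Rightarrow> ((gen \<times> bool) list \<Rightarrow>\<^sub>0 complex) set star_algebra" where
  "OS3 p q \<theta> = presented_star_algebra (S3_relations p q \<theta>)"

definition gen_a :: "real \<Rightarrow> real \<Rightarrow> real \<Rightarrow> ((gen \<times> bool) list \<Rightarrow>\<^sub>0 complex) set" where
  "gen_a p q \<theta> = presented_gen (S3_relations p q \<theta>) GenA"

definition gen_b :: "real \<Rightarrow> real \<Rightarrow> real \<Rightarrow> ((gen \<times> bool) list \<Rightarrow>\<^sub>0 complex) set" where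
  "gen_b p q \<theta> = presented_gen (S3_relations p q \<theta>) GenB"

section \<open>The weighted coaction and its coinvariants\<close>

definition U1_relations :: "((unit \<times> bool) list \<Rightarrow>\<^sub>0 complex) set" where
  "U1_relations =
    (let F = free_star_algebra; u = free_gen () in
      {(u \<otimes>\<^bsub>F\<^esub> star F u) \<ominus>\<^bsub>F\<^esub> \<one>\<^bsub>F\<^esub>, (star F u \<otimes>\<^bsub>F\<^esub> u) \<ominus>\<^bsub>F\<^esub> \<one>\<^bsub>F\<^esub>})"

definition OU1 :: "((unit \<times> bool) list \<Rightarrow>\<^sub>0 complex) set star_algebra" where
  "OU1 = presented_star_algebra U1_relations"

definition gen_u :: "((unit \<times> bool) list \<Rightarrow>\<^sub>0 complex) set" where
  "gen_u = presented_gen U1_relations ()"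

definition u_power :: "int \<Rightarrow> ((unit \<times> bool) list \<Rightarrow>\<^sub>0 complex) set" where
  "u_power n =
    (if n \<ge> 0 then gen_u [^]\<^bsub>OU1\<^esub> nat n else star OU1 gen_u [^]\<^bsub>OU1\<^esub> nat \<bar>n\<bar>)"

text \<open>The Hopf structure of \<open>OU1\<close> is not needed to define the coaction
  and its coinvariants. Extensionality makes the map unique as a HOL function.\<close>

definition weighted_coaction ::
  "real \<Rightarrow> real \<Rightarrow> real \<Rightarrow> int \<Rightarrow> int \<Rightarrow> ((gen \<times> bool) list \<Rightarrow>\<^sub>0 complex) set \<Rightarrow>
   (((gen \<times> bool) list \<Rightarrow>\<^sub>0 complex) set \<times> ((unit \<times> bool) list \<Rightarrow>\<^sub>0 complex) set \<Rightarrow>\<^sub>0 complex) set"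
  where
  "weighted_coaction p q \<theta> k l =
    (THE \<phi>. \<phi> \<in> star_alg_hom (OS3 p q \<theta>) (tensor_algebra (OS3 p q \<theta>) OU1) \<and>
       \<phi> \<in> extensional (carrier (OS3 p q \<theta>)) \<and>
       \<phi> (gen_a p q \<theta>) = pure_tensor (OS3 p q \<theta>) OU1 (gen_a p q \<theta>) (u_power k) \<and>
       \<phi> (gen_b p q \<theta>) = pure_tensor (OS3 p q \<theta>) OU1 (gen_b p q \<theta>) (u_power l))"

definition heegaard_sphere ::
  "real \<Rightarrow> real \<Rightarrow> real \<Rightarrow> int \<Rightarrow> int \<Rightarrow> ((gen \<times> bool) list \<Rightarrow>\<^sub>0 complex) set set" where
  "heegaard_sphere p q \<theta> k l =
    {x \<in> carrier (OS3 p q \<theta>).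
       weighted_coaction p q \<theta> k l x = pure_tensor (OS3 p q \<theta>) OU1 x \<one>\<^bsub>OU1\<^esub>}"

end

theory Submission
  imports Defs
begin

text \<open>
  The relations between \<open>A = 1 - aa\<^sup>*\<close>, \<open>B = 1 - bb\<^sup>*\<close> and \<open>C\<close> are computations. The disc relation for
  \<open>a\<close> says \<open>aa\<^sup>* = 1 - A\<close> and \<open>a\<^sup>*a = 1 - pA\<close>, so \<open>Aa = p aA\<close>; the same holds for \<open>b\<close>, \<open>B\<close>, \<open>q\<close>.
  Each of \<open>a, a\<^sup>*\<close> commutes up to a phase with each of \<open>b, b\<^sup>*\<close>, and the phases cancel in \<open>aa\<^sup>*\<close>
  and \<open>bb\<^sup>*\<close>, so \<open>A\<close> commutes with \<open>b\<close> and \<open>B\<close> with \<open>a\<close>. Write \<open>X n\<close> for \<open>a\<^sup>n\<close> if \<open>n \<ge> 0\<close> and for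
  \<open>a\<^sup>*\<close> to the power \<open>-n\<close> otherwise, and \<open>Y n\<close> likewise for \<open>b\<close>. Then \<open>C = X l Y (-k)\<close> for either sign of
  \<open>l\<close>, and the products \<open>C\<^sup>*C\<close> and \<open>CC\<^sup>*\<close> factor into a product of polynomials in \<open>A\<close> and one
  in \<open>B\<close>. Since \<open>AB = 0\<close>, the first product acts as the identity on \<open>B\<close>, which turns a product of
  the two into their sum minus one.

  For the coinvariants, give \<open>a\<close> degree \<open>k\<close> and \<open>b\<close> degree \<open>l\<close>. The coaction maps a word \<open>w\<close> of degree
  \<open>n\<close> in \<open>a, a\<^sup>*, b, b\<^sup>*\<close> to \<open>w \<otimes> u\<^sup>n\<close>; hence \<open>A\<close>, \<open>B\<close>, \<open>C\<close> are coinvariant, being homogeneous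
  of degree \<open>0\<close>. Conversely, the bilinear map \<open>(x, y) \<mapsto> \<epsilon>(y) x\<close>, with \<open>\<epsilon>(y)\<close> the constant term of
  the Laurent polynomial \<open>y\<close>, induces a linear map \<open>L\<close> on the tensor product. If \<open>x\<close> is coinvariant then
  \<open>L (\<phi> x) = L (x \<otimes> 1) = x\<close>; but if \<open>x\<close> is written as a combination of words, then \<open>L (\<phi> x)\<close> is the
  part of that combination that involves words of degree \<open>0\<close>. So \<open>x\<close> is a combination of such words.
  This avoids a linear basis of the algebra altogether (\<open>coinvariants_subset_generated\<close>).

  It remains to see that a word of degree \<open>0\<close> is a polynomial in \<open>A\<close>, \<open>B\<close>, \<open>C\<close> and \<open>C\<^sup>*\<close>. Every word
  equals \<open>X m Y n d\<close>, where \<open>m\<close> and \<open>n\<close> count the letters with sign and \<open>d\<close> is in the subalgebra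
  generated by \<open>A\<close> and \<open>B\<close> (\<open>word_normal_form\<close>), because that subalgebra can be moved past every
  letter. If \<open>km + ln = 0\<close> then \<open>m = lt\<close> and \<open>n = -kt\<close> for an integer \<open>t\<close>, as \<open>k\<close> and \<open>l\<close> are coprime,
  and \<open>X (lt) Y (-kt)\<close> is up to a scalar a power of \<open>C\<close> or of \<open>C\<^sup>*\<close> (\<open>XY_in_generated\<close>).

  The coaction is a definite description, so all this depends on its existence and uniqueness.
  Existence is the universal property of the presentation with the tensor product as target
  (\<open>presented_lift\<close>, \<open>heegaard_pair_tensor\<close>); it rests on the fact that monoid algebras, quotients by
  star-closed ideals and tensor products are star-algebras. Uniqueness holds because the generators
  generate.
\<close>

section \<open>Star-algebras and their homomorphisms\<close>

text \<open>Powers \<open>x [^] nat n\<close> are kept as natural powers: integer powers are defined through inverses,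
  which an element of a ring need not have.\<close>

declare pow_nat [simp del]

text \<open>In a noncommutative algebra, scalars have to be compatible with the left and with the right factor
  of a product separately.\<close>

locale star_alg = ring S for S :: "('a, 'y) star_algebra_scheme" (structure) +
  assumes smult_closed [simp, intro]: "x \<in> carrier S \<Longrightarrow> c \<odot> x \<in> carrier S"
    and smult_l_distr: "x \<in> carrier S \<Longrightarrow> (c + d) \<odot> x = c \<odot> x \<oplus> d \<odot> x"
    and smult_r_distr: "x \<in> carrier S \<Longrightarrow> y \<in> carrier S \<Longrightarrow> c \<odot> (x \<oplus> y) = c \<odot> x \<oplus> c \<odot> y"
    and smult_smult: "x \<in> carrier S \<Longrightarrow> c \<odot> (d \<odot> x) = (c * d) \<odot> x"
    and smult_one [simp]: "x \<in> carrier S \<Longrightarrow> 1 \<odot> x = x"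
    and smult_mult_l: "x \<in> carrier S \<Longrightarrow> y \<in> carrier S \<Longrightarrow> (c \<odot> x) \<otimes> y = c \<odot> (x \<otimes> y)"
    and smult_mult_r: "x \<in> carrier S \<Longrightarrow> y \<in> carrier S \<Longrightarrow> x \<otimes> (c \<odot> y) = c \<odot> (x \<otimes> y)"
    and star_closed [simp, intro]: "x \<in> carrier S \<Longrightarrow> star S x \<in> carrier S"
    and star_star [simp]: "x \<in> carrier S \<Longrightarrow> star S (star S x) = x"
    and star_add: "x \<in> carrier S \<Longrightarrow> y \<in> carrier S \<Longrightarrow> star S (x \<oplus> y) = star S x \<oplus> star S y"
    and star_mult: "x \<in> carrier S \<Longrightarrow> y \<in> carrier S \<Longrightarrow> star S (x \<otimes> y) = star S y \<otimes> star S x"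
    and star_smult: "x \<in> carrier S \<Longrightarrow> star S (c \<odot> x) = cnj c \<odot> star S x"
begin

lemma smult_zero_left [simp]: "x \<in> carrier S \<Longrightarrow> 0 \<odot> x = \<zero>"
  using smult_l_distr[of x 0 0] by (simp add: add.r_cancel_one')

lemma smult_zero_right [simp]: "c \<odot> \<zero> = \<zero>"
  using smult_r_distr[of \<zero> \<zero> c] by (simp add: add.r_cancel_one')

lemma uminus_eq_smult: "x \<in> carrier S \<Longrightarrow> \<ominus> x = (-1) \<odot> x"
  using smult_l_distr[of x "-1" 1] by (intro minus_equality) auto

lemma minus_eq_smult: "x \<in> carrier S \<Longrightarrow> y \<in> carrier S \<Longrightarrow> x \<ominus> y = x \<oplus> (-1) \<odot> y"
  by (simp add: minus_eq uminus_eq_smult)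

lemma minus_eq_zero_iff: "x \<in> carrier S \<Longrightarrow> y \<in> carrier S \<Longrightarrow> x \<ominus> y = \<zero> \<longleftrightarrow> x = y"
  by (simp add: minus_eq) (metis add.inv_closed add.r_inv minus_equality minus_minus)

lemma star_zero [simp]: "star S \<zero> = \<zero>"
  using star_smult[of \<zero> 0] by simp

lemma star_one [simp]: "star S \<one> = \<one>"
  using star_mult[of "star S \<one>" \<one>] by simp

lemma star_minus: "x \<in> carrier S \<Longrightarrow> y \<in> carrier S \<Longrightarrow> star S (x \<ominus> y) = star S x \<ominus> star S y"
  by (simp add: minus_eq_smult star_add star_smult)

lemma smult_minus: "x \<in> carrier S \<Longrightarrow> y \<in> carrier S \<Longrightarrow> c \<odot> (x \<ominus> y) = c \<odot> x \<ominus> c \<odot> y"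
  by (simp add: minus_eq_smult smult_r_distr smult_smult)

declare minus_closed [simp]

lemma minus_mult_l: "\<lbrakk>x \<in> carrier S; y \<in> carrier S; z \<in> carrier S\<rbrakk> \<Longrightarrow> (x \<ominus> y) \<otimes> z = x \<otimes> z \<ominus> y \<otimes> z"
  by (simp add: minus_eq_smult l_distr smult_mult_l)

lemma minus_mult_r: "\<lbrakk>x \<in> carrier S; y \<in> carrier S; z \<in> carrier S\<rbrakk> \<Longrightarrow> z \<otimes> (x \<ominus> y) = z \<otimes> x \<ominus> z \<otimes> y"
  by (simp add: minus_eq_smult r_distr smult_mult_r)

lemma star_uminus: "x \<in> carrier S \<Longrightarrow> star S (\<ominus> x) = \<ominus> star S x"
  by (simp add: uminus_eq_smult star_smult)

lemma star_pow: "x \<in> carrier S \<Longrightarrow> star S (x [^] (n::nat)) = star S x [^] n"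
  by (induction n) (auto simp: star_mult nat_pow_mult[symmetric] simp flip: nat_pow_Suc2)

lemma submodule_complexI:
  assumes "H \<subseteq> carrier S" "\<zero> \<in> H" "\<And>x y. x \<in> H \<Longrightarrow> y \<in> H \<Longrightarrow> x \<oplus> y \<in> H"
    and "\<And>c x. x \<in> H \<Longrightarrow> c \<odot> x \<in> H"
  shows "submodule H complex_ring S"
proof -
  have m: "\<ominus> x \<in> H" if "x \<in> H" for x
    using that assms(1) assms(4)[of x "-1"] by (auto simp: uminus_eq_smult)
  have "subgroup H (add_monoid S)"
    using assms m by (intro add.subgroupI) auto
  then show ?thesis using assms by (auto simp: submodule_def submodule_axioms_def)
qed

lemma star_subalgebraI:
  assumes "H \<subseteq> carrier S" "\<one> \<in> H" "\<And>x y. x \<in> H \<Longrightarrow> y \<in> H \<Longrightarrow> x \<oplus> y \<in> H"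
    and "\<And>x y. x \<in> H \<Longrightarrow> y \<in> H \<Longrightarrow> x \<otimes> y \<in> H" "\<And>c x. x \<in> H \<Longrightarrow> c \<odot> x \<in> H"
    and "\<And>x. x \<in> H \<Longrightarrow> star S x \<in> H"
  shows "star_subalgebra H S"
proof -
  have z: "\<zero> \<in> H" using assms(1,2) assms(5)[of \<one> 0] by (simp add: subset_iff)
  have m: "\<ominus> x \<in> H" if "x \<in> H" for x
    using that assms(1) assms(5)[of x "-1"] by (auto simp: uminus_eq_smult)
  have g: "subgroup H (add_monoid S)"
    using assms z m by (intro add.subgroupI) auto
  show ?thesis unfolding star_subalgebra_def subring_def submodule_def submodule_axioms_def submonoid_def
    using g assms by auto
qed

end

lemma submodule_complexD:
  assumes "submodule H complex_ring S"
  shows "H \<subseteq> carrier S" "\<zero>\<^bsub>S\<^esub> \<in> H" "\<And>x y. x \<in> H \<Longrightarrow> y \<in> H \<Longrightarrow> x \<oplus>\<^bsub>S\<^esub> y \<in> H"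
    "\<And>c x. x \<in> H \<Longrightarrow> c \<odot>\<^bsub>S\<^esub> x \<in> H" "subgroup H (add_monoid S)"
  using assms unfolding submodule_def submodule_axioms_def
    submonoid_def subgroup_def by (auto simp: complex_ring_def)

lemma star_subalgebraD:
  assumes "star_subalgebra H S"
  shows "H \<subseteq> carrier S" "\<one>\<^bsub>S\<^esub> \<in> H" "\<And>x y. x \<in> H \<Longrightarrow> y \<in> H \<Longrightarrow> x \<oplus>\<^bsub>S\<^esub> y \<in> H"
    "\<And>x y. x \<in> H \<Longrightarrow> y \<in> H \<Longrightarrow> x \<otimes>\<^bsub>S\<^esub> y \<in> H" "\<And>c x. x \<in> H \<Longrightarrow> c \<odot>\<^bsub>S\<^esub> x \<in> H"
    "\<And>x. x \<in> H \<Longrightarrow> star S x \<in> H" "\<zero>\<^bsub>S\<^esub> \<in> H"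
  using assms unfolding star_subalgebra_def subring_def submodule_def submodule_axioms_def
    submonoid_def subgroup_def by (auto simp: complex_ring_def)

context star_alg
begin

lemma star_subalgebra_carrier: "star_subalgebra (carrier S) S"
  by (rule star_subalgebraI) auto

lemma star_subalgebra_minus:
  assumes "star_subalgebra H S" "x \<in> H" "y \<in> H"
  shows "x \<ominus> y \<in> H"
proof -
  note H = star_subalgebraD[OF assms(1)]
  show ?thesis using H(3)[OF assms(2) H(5)[OF assms(3), of "-1"]] H(1) assms
    by (auto simp: minus_eq_smult subset_iff)
qed

lemma generated_star_subalgebra_is_star_subalgebra:
  assumes "X \<subseteq> carrier S"
  shows "star_subalgebra (generated_star_subalgebra S X) S"
  unfolding generated_star_subalgebra_def
proof (rule star_subalgebraI)
  show "\<Inter>{H. star_subalgebra H S \<and> X \<subseteq> H} \<subseteq> carrier S"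
    using star_subalgebra_carrier assms by auto
qed (auto dest: star_subalgebraD)

end

lemma generated_star_subalgebra_incl: "X \<subseteq> generated_star_subalgebra S X"
  by (auto simp: generated_star_subalgebra_def)

lemma generated_star_subalgebra_minimal:
  "star_subalgebra H S \<Longrightarrow> X \<subseteq> H \<Longrightarrow> generated_star_subalgebra S X \<subseteq> H"
  by (auto simp: generated_star_subalgebra_def)

lemma star_alg_homI:
  assumes "\<And>x. x \<in> carrier S \<Longrightarrow> h x \<in> carrier T"
    and "\<And>x y. \<lbrakk>x \<in> carrier S; y \<in> carrier S\<rbrakk> \<Longrightarrow> h (x \<otimes>\<^bsub>S\<^esub> y) = h x \<otimes>\<^bsub>T\<^esub> h y"
    and "\<And>x y. \<lbrakk>x \<in> carrier S; y \<in> carrier S\<rbrakk> \<Longrightarrow> h (x \<oplus>\<^bsub>S\<^esub> y) = h x \<oplus>\<^bsub>T\<^esub> h y"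
    and "h \<one>\<^bsub>S\<^esub> = \<one>\<^bsub>T\<^esub>"
    and "\<And>c x. x \<in> carrier S \<Longrightarrow> h (c \<odot>\<^bsub>S\<^esub> x) = c \<odot>\<^bsub>T\<^esub> h x"
    and "\<And>x. x \<in> carrier S \<Longrightarrow> h (star S x) = star T (h x)"
  shows "h \<in> star_alg_hom S T"
  using assms by (auto simp: star_alg_hom_def ring_hom_def)

locale star_hom = S: star_alg S + T: star_alg T
  for S :: "('a, 'y) star_algebra_scheme" and T :: "('b, 'z) star_algebra_scheme" +
  fixes h :: "'a \<Rightarrow> 'b"
  assumes hom: "h \<in> star_alg_hom S T"
begin

lemma
  shows closed [simp, intro]: "x \<in> carrier S \<Longrightarrow> h x \<in> carrier T"
    and mult: "\<lbrakk>x \<in> carrier S; y \<in> carrier S\<rbrakk> \<Longrightarrow> h (x \<otimes>\<^bsub>S\<^esub> y) = h x \<otimes>\<^bsub>T\<^esub> h y"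
    and add: "\<lbrakk>x \<in> carrier S; y \<in> carrier S\<rbrakk> \<Longrightarrow> h (x \<oplus>\<^bsub>S\<^esub> y) = h x \<oplus>\<^bsub>T\<^esub> h y"
    and one: "h \<one>\<^bsub>S\<^esub> = \<one>\<^bsub>T\<^esub>"
    and smult: "x \<in> carrier S \<Longrightarrow> h (c \<odot>\<^bsub>S\<^esub> x) = c \<odot>\<^bsub>T\<^esub> h x"
    and star: "x \<in> carrier S \<Longrightarrow> h (star S x) = star T (h x)"
  using hom by (auto simp: star_alg_hom_def ring_hom_def)

lemma zero: "h \<zero>\<^bsub>S\<^esub> = \<zero>\<^bsub>T\<^esub>"
  using smult[of "\<zero>\<^bsub>S\<^esub>" 0] by simp

lemma minus: "\<lbrakk>x \<in> carrier S; y \<in> carrier S\<rbrakk> \<Longrightarrow> h (x \<ominus>\<^bsub>S\<^esub> y) = h x \<ominus>\<^bsub>T\<^esub> h y"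
  by (simp add: S.minus_eq_smult T.minus_eq_smult add smult)

lemma pow: "x \<in> carrier S \<Longrightarrow> h (x [^]\<^bsub>S\<^esub> (n::nat)) = h x [^]\<^bsub>T\<^esub> n"
  by (induction n) (auto simp: one mult)

lemmas homs = mult add one smult star zero minus pow

lemma kernel_ideal: "ideal {x \<in> carrier S. h x = \<zero>\<^bsub>T\<^esub>} S"
proof (rule idealI)
  show "subgroup {x \<in> carrier S. h x = \<zero>\<^bsub>T\<^esub>} (add_monoid S)"
    by (rule S.add.subgroupI) (auto simp: homs S.uminus_eq_smult intro!: exI[of _ "\<zero>\<^bsub>S\<^esub>"])
qed (auto simp: homs S.ring_axioms)

lemma equalizer_star_subalgebra:
  assumes "h' \<in> star_alg_hom S T"
  shows "star_subalgebra {x \<in> carrier S. h x = h' x} S"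
proof -
  interpret h': star_hom S T h' by unfold_locales fact
  show ?thesis by (rule S.star_subalgebraI) (auto simp: homs h'.homs)
qed

end

lemma star_homI: "star_alg S \<Longrightarrow> star_alg T \<Longrightarrow> h \<in> star_alg_hom S T \<Longrightarrow> star_hom S T h"
  by (simp add: star_hom_def star_hom_axioms_def)

text \<open>All laws are equations, apart from the existence of negatives, so they pass to the image of a
  map that respects the operations. Quotients are obtained in this way.\<close>

lemma star_alg_image:
  assumes S: "star_alg S"
    and im: "f ` carrier S = carrier T"
    and mult: "\<And>x y. \<lbrakk>x \<in> carrier S; y \<in> carrier S\<rbrakk> \<Longrightarrow> f x \<otimes>\<^bsub>T\<^esub> f y = f (x \<otimes>\<^bsub>S\<^esub> y)"
    and add: "\<And>x y. \<lbrakk>x \<in> carrier S; y \<in> carrier S\<rbrakk> \<Longrightarrow> f x \<oplus>\<^bsub>T\<^esub> f y = f (x \<oplus>\<^bsub>S\<^esub> y)"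
    and one: "\<one>\<^bsub>T\<^esub> = f \<one>\<^bsub>S\<^esub>" and zero: "\<zero>\<^bsub>T\<^esub> = f \<zero>\<^bsub>S\<^esub>"
    and smult: "\<And>c x. x \<in> carrier S \<Longrightarrow> c \<odot>\<^bsub>T\<^esub> f x = f (c \<odot>\<^bsub>S\<^esub> x)"
    and star: "\<And>x. x \<in> carrier S \<Longrightarrow> star T (f x) = f (star S x)"
  shows "star_alg T"
proof -
  interpret S: star_alg S by fact
  note ops = mult add one zero smult star
  have T: "\<exists>y\<in>carrier S. x = f y" if "x \<in> carrier T" for x using that im by auto
  have cl: "f x \<in> carrier T" if "x \<in> carrier S" for x using that im by auto
  have 1: "abelian_group T"
  proof (rule abelian_groupI)
    fix x assume "x \<in> carrier T"
    then obtain y where y: "y \<in> carrier S" "x = f y" using T by blast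
    show "\<exists>z\<in>carrier T. z \<oplus>\<^bsub>T\<^esub> x = \<zero>\<^bsub>T\<^esub>"
      using y by (intro bexI[of _ "f (\<ominus>\<^bsub>S\<^esub> y)"]) (auto simp: ops cl S.l_neg)
  qed (use S.a_assoc S.a_comm in \<open>auto dest!: T simp: ops cl\<close>)
  have 2: "Group.monoid T"
    by (rule monoidI) (use S.m_assoc in \<open>auto dest!: T simp: ops cl\<close>)
  have "ring T" by (rule ringI[OF 1 2]) (auto dest!: T simp: ops cl S.l_distr S.r_distr)
  then show ?thesis
    unfolding star_alg_def star_alg_axioms_def
    by (auto dest!: T simp: ops cl S.smult_l_distr S.smult_r_distr S.smult_smult S.smult_mult_l
        S.smult_mult_r S.star_add S.star_mult S.star_smult)
qed

section \<open>Quotients by star-closed ideals\<close>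

locale star_ideal = star_alg S + ideal I S for S :: "('a, 'y) star_algebra_scheme" (structure) and I +
  assumes star_mem: "x \<in> I \<Longrightarrow> star S x \<in> I"
begin

abbreviation "Q \<equiv> quot_star_algebra S I"

lemma coset_eq_iff: "x \<in> carrier S \<Longrightarrow> y \<in> carrier S \<Longrightarrow> I +> x = I +> y \<longleftrightarrow> x \<ominus> y \<in> I"
  using quotient_eq_iff_same_a_r_cos[OF ideal_axioms] by blast

lemma smult_mem: "x \<in> I \<Longrightarrow> c \<odot> x \<in> I"
  using I_l_closed[of x "c \<odot> \<one>"] by (simp add: smult_mult_l a_Hcarr)

text \<open>A unary operation that is additive and preserves the ideal acts on cosets, so the union over all
  representatives in \<^const>\<open>quot_star_algebra\<close> is a single coset.\<close>

lemma coset_op: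
  assumes f: "\<And>x. x \<in> carrier S \<Longrightarrow> f x \<in> carrier S" "\<And>x. x \<in> I \<Longrightarrow> f x \<in> I"
    "\<And>x y. x \<in> carrier S \<Longrightarrow> y \<in> carrier S \<Longrightarrow> f (x \<ominus> y) = f x \<ominus> f y"
    and x: "x \<in> carrier S"
  shows "(\<Union>y\<in>I +> x. I +> f y) = I +> f x"
proof -
  have "I +> f y = I +> f x" if "y \<in> I +> x" for y
  proof -
    have y: "y \<in> carrier S" using that x a_r_coset_subset_G a_subset by blast
    have "I +> y = I +> x" using that x a_repr_independence a_subgroup by metis
    then have "y \<ominus> x \<in> I" using coset_eq_iff x y by simp
    then have "f y \<ominus> f x \<in> I" using f x y by metis
    then show ?thesis using coset_eq_iff f x y by simp
  qed
  moreover have "x \<in> I +> x" using x a_rcos_self by simp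
  ultimately show ?thesis by blast
qed

lemma quot_carrier: "carrier Q = (+>) I ` carrier S"
  by (auto simp: quot_star_algebra_def FactRing_def A_RCOSETS_def')

lemma quot_ops:
  shows quot_mult: "\<lbrakk>x \<in> carrier S; y \<in> carrier S\<rbrakk> \<Longrightarrow> (I +> x) \<otimes>\<^bsub>Q\<^esub> (I +> y) = I +> x \<otimes> y"
    and quot_add: "\<lbrakk>x \<in> carrier S; y \<in> carrier S\<rbrakk> \<Longrightarrow> (I +> x) \<oplus>\<^bsub>Q\<^esub> (I +> y) = I +> (x \<oplus> y)"
    and quot_one: "\<one>\<^bsub>Q\<^esub> = I +> \<one>" and quot_zero: "\<zero>\<^bsub>Q\<^esub> = I +> \<zero>"
    and quot_smult: "x \<in> carrier S \<Longrightarrow> c \<odot>\<^bsub>Q\<^esub> (I +> x) = I +> c \<odot> x"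
    and quot_star: "x \<in> carrier S \<Longrightarrow> star Q (I +> x) = I +> star S x"
proof -
  show "c \<odot>\<^bsub>Q\<^esub> (I +> x) = I +> c \<odot> x" if "x \<in> carrier S"
    using that coset_op[of "\<lambda>x. c \<odot> x" x] by (simp add: quot_star_algebra_def smult_mem smult_minus)
  show "star Q (I +> x) = I +> star S x" if "x \<in> carrier S"
    using that coset_op[of "star S" x] by (simp add: quot_star_algebra_def star_mem star_minus)
qed (use a_subset in \<open>auto simp: quot_star_algebra_def FactRing_def rcoset_mult_add a_rcos_sum\<close>)

lemma quot_star_alg: "star_alg Q"
  by (rule star_alg_image[where f = "(+>) I", OF star_alg_axioms])
    (auto simp: quot_ops quot_carrier)

lemma coset_hom: "(+>) I \<in> star_alg_hom S Q"
  by (rule star_alg_homI) (auto simp: quot_ops quot_carrier)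

sublocale quot: star_hom S Q "(+>) I"
  by (intro star_homI star_alg_axioms quot_star_alg coset_hom)

lemma coset_eq_zero_iff: "x \<in> carrier S \<Longrightarrow> I +> x = \<zero>\<^bsub>Q\<^esub> \<longleftrightarrow> x \<in> I"
  using coset_eq_iff[of x \<zero>] by (simp add: quot_zero minus_eq)

text \<open>This is for maps that need not be multiplicative, such as the functionals on tensor products.\<close>

lemma quot_lift:
  assumes "\<And>x y. x \<in> carrier S \<Longrightarrow> y \<in> carrier S \<Longrightarrow> x \<ominus> y \<in> I \<Longrightarrow> f x = f y"
  obtains g where "\<And>x. x \<in> carrier S \<Longrightarrow> g (I +> x) = f x"
proof
  fix x assume x: "x \<in> carrier S"
  have "\<exists>y. y \<in> carrier S \<and> I +> y = I +> x" using x by blast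
  then have "(SOME y. y \<in> carrier S \<and> I +> y = I +> x) \<in> carrier S
    \<and> I +> (SOME y. y \<in> carrier S \<and> I +> y = I +> x) = I +> x" by (rule someI_ex)
  then show "(\<lambda>X. f (SOME y. y \<in> carrier S \<and> I +> y = X)) (I +> x) = f x"
    using assms[OF _ x] coset_eq_iff[OF _ x] by blast
qed

lemma quot_hom_lift:
  assumes "star_alg T" "h \<in> star_alg_hom S T" "\<And>x. x \<in> I \<Longrightarrow> h x = \<zero>\<^bsub>T\<^esub>"
  obtains g where "g \<in> star_alg_hom Q T" "\<And>x. x \<in> carrier S \<Longrightarrow> g (I +> x) = h x"
proof -
  interpret h: star_hom S T h by (intro star_homI star_alg_axioms assms(1,2))
  have "h x = h y" if "x \<in> carrier S" "y \<in> carrier S" "x \<ominus> y \<in> I" for x y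
    using assms(3)[OF that(3)] that(1,2) by (simp add: h.minus h.T.minus_eq_zero_iff)
  then obtain g where g: "\<And>x. x \<in> carrier S \<Longrightarrow> g (I +> x) = h x" using quot_lift by metis
  moreover have "g \<in> star_alg_hom Q T"
    by (rule star_alg_homI) (auto simp: quot_carrier quot_ops g h.homs)
  ultimately show thesis using that by blast
qed

end

section \<open>Monoid algebras\<close>

text \<open>Every finitely supported function is a sum of one-point functions; identities that are additive
  in each argument need only be checked on these.\<close>

lemma poly_mapping_keys_induct [consumes 1, case_names zero single add]:
  fixes f :: "'s \<Rightarrow>\<^sub>0 'c::comm_monoid_add"
  assumes f: "Poly_Mapping.keys f \<subseteq> X"
    and zero: "P 0"
    and single: "\<And>s c. s \<in> X \<Longrightarrow> P (Poly_Mapping.single s c)"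
    and add: "\<And>f g. Poly_Mapping.keys f \<subseteq> X \<Longrightarrow> Poly_Mapping.keys g \<subseteq> X \<Longrightarrow> P f \<Longrightarrow> P g \<Longrightarrow> P (f + g)"
  shows "P f"
proof -
  let ?s = "\<lambda>Y. \<Sum>s\<in>Y. Poly_Mapping.single s (Poly_Mapping.lookup f s)"
  have "P (?s Y) \<and> Poly_Mapping.keys (?s Y) \<subseteq> X" if "finite Y" "Y \<subseteq> X" for Y
    using that
  proof (induction Y)
    case (insert s Y)
    let ?t = "Poly_Mapping.single s (Poly_Mapping.lookup f s)"
    have t: "Poly_Mapping.keys ?t \<subseteq> X" "P ?t"
      using insert by (auto intro: single)
    have eq: "?s (insert s Y) = ?t + ?s Y" using insert by simp
    have IH: "P (?s Y)" "Poly_Mapping.keys (?s Y) \<subseteq> X" using insert by blast+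
    show ?case unfolding eq using add[OF t(1) IH(2) t(2) IH(1)] keys_add[of ?t "?s Y"] t(1) IH(2) by blast
  qed (use zero in auto)
  then have "P (?s (Poly_Mapping.keys f))" using f by simp
  moreover have "?s (Poly_Mapping.keys f) = f"
    by (rule poly_mapping_eqI)
      (auto simp: lookup_sum lookup_single when_def sum.delta in_keys_iff)
  ultimately show ?thesis by simp
qed

text \<open>The data from which \<^const>\<open>monoid_star_algebra\<close> makes a star-algebra: \<open>CM\<close> below stands for
  \<open>\<complex>[M]\<close>.\<close>

locale star_monoid = Group.monoid M for M :: "('m, 'z) monoid_scheme" (structure) +
  fixes \<sigma> :: "'m \<Rightarrow> 'm"
  assumes \<sigma>_closed [simp]: "x \<in> carrier M \<Longrightarrow> \<sigma> x \<in> carrier M"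
    and \<sigma>_\<sigma> [simp]: "x \<in> carrier M \<Longrightarrow> \<sigma> (\<sigma> x) = x"
    and \<sigma>_mult: "x \<in> carrier M \<Longrightarrow> y \<in> carrier M \<Longrightarrow> \<sigma> (x \<otimes> y) = \<sigma> y \<otimes> \<sigma> x"
begin

abbreviation "CM \<equiv> monoid_star_algebra M \<sigma>"

lemma carrier_CM: "f \<in> carrier CM \<longleftrightarrow> Poly_Mapping.keys f \<subseteq> carrier M"
  and add_CM: "f \<oplus>\<^bsub>CM\<^esub> g = f + g"
  and zero_CM: "\<zero>\<^bsub>CM\<^esub> = 0"
  and one_CM: "\<one>\<^bsub>CM\<^esub> = Poly_Mapping.single \<one> 1"
  by (auto simp: monoid_star_algebra_def)

lemma single_carrier: "s \<in> carrier M \<Longrightarrow> Poly_Mapping.single s c \<in> carrier CM"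
  by (simp add: carrier_CM)

lemma lookup_smult_CM: "Poly_Mapping.lookup (c \<odot>\<^bsub>CM\<^esub> f) s = c * Poly_Mapping.lookup f s"
  by (simp add: monoid_star_algebra_def Poly_Mapping.map.rep_eq when_def)

lemma smult_CM_add: "c \<odot>\<^bsub>CM\<^esub> (f + g) = c \<odot>\<^bsub>CM\<^esub> f + c \<odot>\<^bsub>CM\<^esub> g"
  and smult_CM_single: "c \<odot>\<^bsub>CM\<^esub> Poly_Mapping.single s d = Poly_Mapping.single s (c * d)"
  and smult_CM_zero: "c \<odot>\<^bsub>CM\<^esub> 0 = 0"
  by (auto intro!: poly_mapping_eqI simp: lookup_smult_CM lookup_add algebra_simps lookup_single when_def)

lemma mult_CM_zero: "f \<otimes>\<^bsub>CM\<^esub> 0 = 0" "0 \<otimes>\<^bsub>CM\<^esub> f = 0"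
  by (auto simp: monoid_star_algebra_def)

lemma mult_CM_single:
  "Poly_Mapping.single s c \<otimes>\<^bsub>CM\<^esub> Poly_Mapping.single t d = Poly_Mapping.single (s \<otimes> t) (c * d)"
  by (auto simp: monoid_star_algebra_def)

lemma mult_CM_add_left: "(f + g) \<otimes>\<^bsub>CM\<^esub> h = f \<otimes>\<^bsub>CM\<^esub> h + g \<otimes>\<^bsub>CM\<^esub> h"
  unfolding monoid_star_algebra_def
  by (simp, subst setsum_keys_plus_distrib) (auto simp: distrib_right single_add sum.distrib)

lemma mult_CM_add_right: "f \<otimes>\<^bsub>CM\<^esub> (g + h) = f \<otimes>\<^bsub>CM\<^esub> g + f \<otimes>\<^bsub>CM\<^esub> h"
  unfolding monoid_star_algebra_def
  by (simp, subst setsum_keys_plus_distrib) (auto simp: distrib_left single_add sum.distrib)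

lemma star_CM_zero: "star CM 0 = 0"
  and star_CM_single: "star CM (Poly_Mapping.single s c) = Poly_Mapping.single (\<sigma> s) (cnj c)"
  by (auto simp: monoid_star_algebra_def)

lemma star_CM_add: "star CM (f + g) = star CM f + star CM g"
  unfolding monoid_star_algebra_def
  by (simp, subst setsum_keys_plus_distrib) (auto simp: single_add)

lemma mult_CM_diff_left: "(f - g) \<otimes>\<^bsub>CM\<^esub> h = f \<otimes>\<^bsub>CM\<^esub> h - g \<otimes>\<^bsub>CM\<^esub> h"
  using mult_CM_add_left[of "f - g" g h] by simp

lemma mult_CM_diff_right: "f \<otimes>\<^bsub>CM\<^esub> (g - h) = f \<otimes>\<^bsub>CM\<^esub> g - f \<otimes>\<^bsub>CM\<^esub> h"
  using mult_CM_add_right[of f "g - h" h] by simp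

lemma star_CM_diff: "star CM (f - g) = star CM f - star CM g"
  using star_CM_add[of "f - g" g] by simp

lemmas CM_simps = add_CM zero_CM one_CM smult_CM_add smult_CM_single smult_CM_zero mult_CM_zero
  mult_CM_single mult_CM_add_left mult_CM_add_right star_CM_zero star_CM_single star_CM_add

lemma CM_induct [consumes 1, case_names zero single add]:
  assumes "f \<in> carrier CM" "P 0" "\<And>s c. s \<in> carrier M \<Longrightarrow> P (Poly_Mapping.single s c)"
    and "\<And>f g. \<lbrakk>f \<in> carrier CM; g \<in> carrier CM; P f; P g\<rbrakk> \<Longrightarrow> P (f + g)"
  shows "P f"
  using poly_mapping_keys_induct[of f "carrier M" P] assms by (auto simp: carrier_CM)

lemma carrier_add: "f \<in> carrier CM \<Longrightarrow> g \<in> carrier CM \<Longrightarrow> f + g \<in> carrier CM"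
  using keys_add[of f g] by (auto simp: carrier_CM)

lemma zero_carrier: "0 \<in> carrier CM" by (simp add: carrier_CM)

lemma mult_CM_closed: "f \<in> carrier CM \<Longrightarrow> g \<in> carrier CM \<Longrightarrow> f \<otimes>\<^bsub>CM\<^esub> g \<in> carrier CM"
proof (induction f rule: CM_induct)
  case (single s c)
  from single(2,1) show ?case
    by (induction g rule: CM_induct) (auto simp: CM_simps carrier_add zero_carrier single_carrier)
qed (auto simp: CM_simps carrier_add zero_carrier)

lemma mult_CM_assoc:
  "f \<in> carrier CM \<Longrightarrow> g \<in> carrier CM \<Longrightarrow> h \<in> carrier CM \<Longrightarrow>
    (f \<otimes>\<^bsub>CM\<^esub> g) \<otimes>\<^bsub>CM\<^esub> h = f \<otimes>\<^bsub>CM\<^esub> (g \<otimes>\<^bsub>CM\<^esub> h)"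
proof (induction f rule: CM_induct)
  case (single s c)
  from single(2,1,3) show ?case
  proof (induction g rule: CM_induct)
    case (single t d)
    from single(3,1,2) show ?case
      by (induction h rule: CM_induct) (auto simp: CM_simps m_assoc mult.assoc)
  qed (auto simp: CM_simps)
qed (auto simp: CM_simps)

lemma star_CM_mult:
  "f \<in> carrier CM \<Longrightarrow> g \<in> carrier CM \<Longrightarrow> star CM (f \<otimes>\<^bsub>CM\<^esub> g) = star CM g \<otimes>\<^bsub>CM\<^esub> star CM f"
proof (induction f rule: CM_induct)
  case (single s c)
  from single(2,1) show ?case
    by (induction g rule: CM_induct) (auto simp: CM_simps \<sigma>_mult mult.commute)
qed (auto simp: CM_simps)

lemma smult_CM_mult:
  assumes "f \<in> carrier CM" "g \<in> carrier CM"
  shows "(c \<odot>\<^bsub>CM\<^esub> f) \<otimes>\<^bsub>CM\<^esub> g = c \<odot>\<^bsub>CM\<^esub> (f \<otimes>\<^bsub>CM\<^esub> g)"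
    and "f \<otimes>\<^bsub>CM\<^esub> (c \<odot>\<^bsub>CM\<^esub> g) = c \<odot>\<^bsub>CM\<^esub> (f \<otimes>\<^bsub>CM\<^esub> g)"
proof -
  have "(c \<odot>\<^bsub>CM\<^esub> f) \<otimes>\<^bsub>CM\<^esub> g = c \<odot>\<^bsub>CM\<^esub> (f \<otimes>\<^bsub>CM\<^esub> g) \<and>
    f \<otimes>\<^bsub>CM\<^esub> (c \<odot>\<^bsub>CM\<^esub> g) = c \<odot>\<^bsub>CM\<^esub> (f \<otimes>\<^bsub>CM\<^esub> g)"
    using assms
  proof (induction f rule: CM_induct)
    case (single s c)
    from single(2,1) show ?case
      by (induction g rule: CM_induct) (auto simp: CM_simps ac_simps)
  qed (auto simp: CM_simps)
  then show "(c \<odot>\<^bsub>CM\<^esub> f) \<otimes>\<^bsub>CM\<^esub> g = c \<odot>\<^bsub>CM\<^esub> (f \<otimes>\<^bsub>CM\<^esub> g)"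
    and "f \<otimes>\<^bsub>CM\<^esub> (c \<odot>\<^bsub>CM\<^esub> g) = c \<odot>\<^bsub>CM\<^esub> (f \<otimes>\<^bsub>CM\<^esub> g)" by auto
qed

text \<open>Addition and scaling are pointwise. The laws that involve products or the involution reduce to
  one-point functions, that is, to the laws of the monoid.\<close>

lemma star_alg_CM: "star_alg CM"
proof -
  have 1: "abelian_group CM"
  proof (rule abelian_groupI)
    show "\<exists>g\<in>carrier CM. g \<oplus>\<^bsub>CM\<^esub> f = \<zero>\<^bsub>CM\<^esub>" if "f \<in> carrier CM" for f
      using that by (intro bexI[of _ "- f"]) (auto simp: CM_simps carrier_CM in_keys_iff subset_iff)
  qed (auto simp: CM_simps carrier_add zero_carrier)
  have one_l: "Poly_Mapping.single \<one> 1 \<otimes>\<^bsub>CM\<^esub> f = f \<and> f \<otimes>\<^bsub>CM\<^esub> Poly_Mapping.single \<one> 1 = f"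
    if "f \<in> carrier CM" for f
    using that by (induction f rule: CM_induct) (auto simp: CM_simps)
  have 2: "Group.monoid CM"
    by (rule monoidI) (auto simp: mult_CM_closed one_CM single_carrier mult_CM_assoc one_l)
  have 3: "ring CM" by (rule ringI[OF 1 2]) (auto simp: CM_simps)
  have cl: "c \<odot>\<^bsub>CM\<^esub> f \<in> carrier CM" "star CM f \<in> carrier CM" if "f \<in> carrier CM" for f c
    using that by (induction f rule: CM_induct)
      (auto simp: CM_simps zero_carrier single_carrier intro: carrier_add)
  have st: "star CM (star CM f) = f" "star CM (c \<odot>\<^bsub>CM\<^esub> f) = cnj c \<odot>\<^bsub>CM\<^esub> star CM f"
    if "f \<in> carrier CM" for f c
    using that by (induction f rule: CM_induct) (auto simp: CM_simps)
  show ?thesis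
    unfolding star_alg_def star_alg_axioms_def
    using 3 by (auto simp: cl st smult_CM_mult star_CM_mult add_CM smult_CM_add star_CM_add
        intro!: poly_mapping_eqI simp: lookup_smult_CM lookup_add algebra_simps)
qed

sublocale CM: star_alg CM by (rule star_alg_CM)

lemma minus_CM: "g \<in> carrier CM \<Longrightarrow> f \<in> carrier CM \<Longrightarrow> f \<ominus>\<^bsub>CM\<^esub> g = f - g"
  unfolding CM.minus_eq_smult add_CM
  by (rule poly_mapping_eqI) (simp add: lookup_smult_CM lookup_add lookup_minus)

end

section \<open>Linear extension\<close>

definition linear_extension ::
  "('b, 'z) star_algebra_scheme \<Rightarrow> ('s \<Rightarrow> 'b) \<Rightarrow> ('s \<Rightarrow>\<^sub>0 complex) \<Rightarrow> 'b" where
  "linear_extension T F f = finsum T (\<lambda>s. Poly_Mapping.lookup f s \<odot>\<^bsub>T\<^esub> F s) (Poly_Mapping.keys f)"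

context star_alg
begin

lemma linear_extension_superset:
  assumes "finite Y" "Poly_Mapping.keys f \<subseteq> Y" "F \<in> Y \<rightarrow> carrier S"
  shows "linear_extension S F f = finsum S (\<lambda>s. Poly_Mapping.lookup f s \<odot> F s) Y"
  unfolding linear_extension_def using assms
  by (intro add.finprod_mono_neutral_cong_left) (auto simp: in_keys_iff Pi_iff)

lemma linear_extension_zero [simp]: "linear_extension S F 0 = \<zero>"
  by (simp add: linear_extension_def)

lemma linear_extension_closed:
  "Poly_Mapping.keys f \<subseteq> X \<Longrightarrow> F \<in> X \<rightarrow> carrier S \<Longrightarrow> linear_extension S F f \<in> carrier S"
  unfolding linear_extension_def by (rule finsum_closed) auto

lemma linear_extension_single:
  "F s \<in> carrier S \<Longrightarrow> linear_extension S F (Poly_Mapping.single s c) = c \<odot> F s"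
  by (subst linear_extension_superset[of "{s}"]) auto

lemma linear_extension_add:
  assumes "Poly_Mapping.keys f \<subseteq> X" "Poly_Mapping.keys g \<subseteq> X" "F \<in> X \<rightarrow> carrier S"
  shows "linear_extension S F (f + g) = linear_extension S F f \<oplus> linear_extension S F g"
proof -
  let ?Y = "Poly_Mapping.keys f \<union> Poly_Mapping.keys g"
  have F: "F \<in> ?Y \<rightarrow> carrier S" using assms by auto
  have *: "(\<lambda>s. Poly_Mapping.lookup h s \<odot> F s) \<in> ?Y \<rightarrow> carrier S" for h using F by auto
  have "linear_extension S F (f + g) = finsum S (\<lambda>s. Poly_Mapping.lookup (f + g) s \<odot> F s) ?Y"
    using F by (intro linear_extension_superset keys_add) auto
  also have "\<dots> = finsum S (\<lambda>s. Poly_Mapping.lookup f s \<odot> F s \<oplus> Poly_Mapping.lookup g s \<odot> F s) ?Y"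
    using F by (intro finsum_cong') (auto simp: lookup_add Pi_iff intro!: smult_l_distr)
  also have "\<dots> = finsum S (\<lambda>s. Poly_Mapping.lookup f s \<odot> F s) ?Y \<oplus> finsum S (\<lambda>s. Poly_Mapping.lookup g s \<odot> F s) ?Y"
    by (rule finsum_addf[OF * *])
  finally show ?thesis using F by (simp add: linear_extension_superset[of ?Y])
qed

end

context star_monoid
begin

context
  fixes T :: "('t, 'w) star_algebra_scheme" and F :: "'m \<Rightarrow> 't"
  assumes T: "star_alg T" and F: "F \<in> carrier M \<rightarrow> carrier T"
begin

interpretation T: star_alg T by (rule T)

lemma linear_extension_CM_add:
  "\<lbrakk>f \<in> carrier CM; g \<in> carrier CM\<rbrakk> \<Longrightarrow>
    linear_extension T F (f + g) = linear_extension T F f \<oplus>\<^bsub>T\<^esub> linear_extension T F g"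
  using T.linear_extension_add[of f "carrier M" g F] F by (simp add: carrier_CM)

lemma linear_extension_CM_closed: "f \<in> carrier CM \<Longrightarrow> linear_extension T F f \<in> carrier T"
  using T.linear_extension_closed[of f "carrier M" F] F by (simp add: carrier_CM)

lemma linear_extension_CM_single:
  "s \<in> carrier M \<Longrightarrow> linear_extension T F (Poly_Mapping.single s c) = c \<odot>\<^bsub>T\<^esub> F s"
  by (rule T.linear_extension_single) (use F in auto)

lemma linear_extension_CM_smult:
  assumes "f \<in> carrier CM"
  shows "linear_extension T F (c \<odot>\<^bsub>CM\<^esub> f) = c \<odot>\<^bsub>T\<^esub> linear_extension T F f"
  using assms
proof (induction f rule: CM_induct)
  case (add f g)
  then have "c \<odot>\<^bsub>CM\<^esub> f \<in> carrier CM" "c \<odot>\<^bsub>CM\<^esub> g \<in> carrier CM" by auto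
  with add show ?case
    by (simp add: CM_simps linear_extension_CM_add T.smult_r_distr linear_extension_CM_closed)
qed (use F in \<open>auto simp: CM_simps linear_extension_CM_single T.smult_smult Pi_iff\<close>)

text \<open>The universal property of \<open>\<complex>[M]\<close>: a star-preserving monoid homomorphism into a star-algebra
  extends to a homomorphism of star-algebras.\<close>

lemma linear_extension_CM_hom:
  assumes one: "F \<one> = \<one>\<^bsub>T\<^esub>"
    and mult: "\<And>s t. \<lbrakk>s \<in> carrier M; t \<in> carrier M\<rbrakk> \<Longrightarrow> F (s \<otimes> t) = F s \<otimes>\<^bsub>T\<^esub> F t"
    and star: "\<And>s. s \<in> carrier M \<Longrightarrow> F (\<sigma> s) = star T (F s)"
  shows "linear_extension T F \<in> star_alg_hom CM T"
proof (rule star_alg_homI)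
  note simps = CM_simps linear_extension_CM_add linear_extension_CM_single linear_extension_CM_closed
  note Fs = F[THEN funcset_mem]
  show "linear_extension T F (f \<otimes>\<^bsub>CM\<^esub> g) = linear_extension T F f \<otimes>\<^bsub>T\<^esub> linear_extension T F g"
    if "f \<in> carrier CM" "g \<in> carrier CM" for f g
    using that
  proof (induction f rule: CM_induct)
    case (single s c)
    from single(2,1) show ?case
    proof (induction g rule: CM_induct)
      case (add f g)
      have "Poly_Mapping.single s c \<otimes>\<^bsub>CM\<^esub> f \<in> carrier CM" "Poly_Mapping.single s c \<otimes>\<^bsub>CM\<^esub> g \<in> carrier CM"
        using add by (auto intro!: mult_CM_closed single_carrier)
      with add show ?case by (simp add: simps T.r_distr Fs)
    qed (auto simp: simps Fs mult T.smult_mult_l T.smult_mult_r T.smult_smult mult.commute)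
  next
    case (add f f')
    then have "f \<otimes>\<^bsub>CM\<^esub> g \<in> carrier CM" "f' \<otimes>\<^bsub>CM\<^esub> g \<in> carrier CM"
      by (auto intro!: mult_CM_closed)
    with add show ?case by (simp add: simps T.l_distr)
  qed (auto simp: simps)
  show "linear_extension T F (star CM f) = star T (linear_extension T F f)"
    if "f \<in> carrier CM" for f
    using that
  proof (induction f rule: CM_induct)
    case (add f g)
    then have "star CM f \<in> carrier CM" "star CM g \<in> carrier CM" by auto
    with add show ?case by (simp add: simps T.star_add)
  qed (auto simp: simps Fs star T.star_smult)
qed (auto simp: linear_extension_CM_add linear_extension_CM_closed linear_extension_CM_smult add_CM
    one_CM linear_extension_CM_single one)

end

end

section \<open>Free and presented star-algebras\<close>

interpretation word: star_monoid "word_monoid :: ('g \<times> bool) list monoid" word_star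
  rewrites "monoid_star_algebra word_monoid word_star = (free_star_algebra :: (('g \<times> bool) list \<Rightarrow>\<^sub>0 complex) star_algebra)"
proof -
  show "star_monoid (word_monoid :: ('g \<times> bool) list monoid) word_star"
    by unfold_locales (auto simp: word_monoid_def word_star_def rev_map o_def apsnd_def map_prod_def split_def)
qed (simp add: free_star_algebra_def)

lemma carrier_free [simp]: "carrier free_star_algebra = UNIV"
  by (auto simp: word.carrier_CM word_monoid_def)

lemma free_mult_single: "Poly_Mapping.single v c \<otimes>\<^bsub>free_star_algebra\<^esub> Poly_Mapping.single w d = Poly_Mapping.single (v @ w) (c * d)"
  by (simp add: word.mult_CM_single) (simp add: word_monoid_def)

definition word_value :: "('b, 'z) star_algebra_scheme \<Rightarrow> ('g \<Rightarrow> 'b) \<Rightarrow> ('g \<times> bool) list \<Rightarrow> 'b" where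
  "word_value T \<gamma> w = foldr (\<lambda>(g, b) x. (if b then star T (\<gamma> g) else \<gamma> g) \<otimes>\<^bsub>T\<^esub> x) w \<one>\<^bsub>T\<^esub>"

context star_alg
begin

context
  fixes \<gamma> :: "'g \<Rightarrow> 'a"
  assumes \<gamma>: "\<And>g. \<gamma> g \<in> carrier S"
begin

lemma word_value_closed: "word_value S \<gamma> w \<in> carrier S"
  by (induction w) (auto simp: word_value_def \<gamma>)

lemma word_value_append: "word_value S \<gamma> (v @ w) = word_value S \<gamma> v \<otimes> word_value S \<gamma> w"
  using word_value_closed by (induction v) (auto simp: word_value_def \<gamma> m_assoc)

lemma word_value_star: "word_value S \<gamma> (word_star w) = star S (word_value S \<gamma> w)"
proof (induction w)
  case (Cons x w)
  obtain g b where x: "x = (g, b)" by force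
  have "word_star (x # w) = word_star w @ [(g, \<not> b)]" by (simp add: word_star_def x)
  moreover have "word_value S \<gamma> (x # w) = word_value S \<gamma> [(g, b)] \<otimes> word_value S \<gamma> w"
    using word_value_append[of "[x]" w] by (simp add: x)
  moreover have "word_value S \<gamma> [(g, \<not> b)] = star S (word_value S \<gamma> [(g, b)])"
    by (simp add: word_value_def \<gamma>)
  ultimately show ?case
    using Cons word_value_closed by (simp add: word_value_append star_mult)
qed (simp add: word_star_def word_value_def)

lemma free_lift:
  shows "linear_extension S (word_value S \<gamma>) \<in> star_alg_hom free_star_algebra S"
    and "linear_extension S (word_value S \<gamma>) (free_gen g) = \<gamma> g"
proof -
  have *: "word_value S \<gamma> \<in> carrier word_monoid \<rightarrow> carrier S" using word_value_closed by auto
  show "linear_extension S (word_value S \<gamma>) \<in> star_alg_hom free_star_algebra S"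
    by (rule word.linear_extension_CM_hom[OF star_alg_axioms *])
      (simp_all add: word_value_append word_value_star word_monoid_def, simp add: word_value_def)
  show "linear_extension S (word_value S \<gamma>) (free_gen g) = \<gamma> g"
    unfolding free_gen_def using \<gamma>
    by (subst linear_extension_single) (auto simp: word_value_def)
qed

end

end

text \<open>The preimage of the ideal under the involution is again an ideal, and it contains the generators
  because they come together with their adjoints.\<close>

lemma relation_ideal_star_ideal: "star_ideal free_star_algebra (relation_ideal R)"
proof -
  let ?F = free_star_algebra and ?R = "R \<union> star free_star_algebra ` R"
  interpret I: ideal "relation_ideal R" ?F
    unfolding relation_ideal_def by (rule word.CM.genideal_ideal) simp
  have "ideal {x. star ?F x \<in> relation_ideal R} ?F"
  proof (rule idealI)
    show "subgroup {x. star ?F x \<in> relation_ideal R} (add_monoid ?F)"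
      by (rule word.CM.add.subgroupI)
        (auto simp: word.CM.star_add word.CM.star_uminus intro!: exI[of _ "\<zero>\<^bsub>?F\<^esub>"])
  qed (auto simp: word.CM.star_mult word.CM.ring_axioms I.I_l_closed I.I_r_closed)
  moreover have "?R \<subseteq> {x. star ?F x \<in> relation_ideal R}"
    using word.CM.genideal_self[of ?R] by (auto simp: relation_ideal_def)
  ultimately have "relation_ideal R \<subseteq> {x. star ?F x \<in> relation_ideal R}"
    unfolding relation_ideal_def by (rule word.CM.genideal_minimal)
  then show ?thesis by unfold_locales auto
qed

lemmas presented_star_alg = star_ideal.quot_star_alg[OF relation_ideal_star_ideal, folded presented_star_algebra_def]
  and presented_coset_hom = star_ideal.coset_hom[OF relation_ideal_star_ideal, folded presented_star_algebra_def]
  and presented_coset_eq_zero_iff = star_ideal.coset_eq_zero_iff[OF relation_ideal_star_ideal, folded presented_star_algebra_def]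
  and presented_quot_carrier = star_ideal.quot_carrier[OF relation_ideal_star_ideal, folded presented_star_algebra_def]
  and presented_quot_mult = star_ideal.quot_mult[OF relation_ideal_star_ideal, folded presented_star_algebra_def]
  and presented_quot_add = star_ideal.quot_add[OF relation_ideal_star_ideal, folded presented_star_algebra_def]
  and presented_quot_one = star_ideal.quot_one[OF relation_ideal_star_ideal, folded presented_star_algebra_def]
  and presented_quot_smult = star_ideal.quot_smult[OF relation_ideal_star_ideal, folded presented_star_algebra_def]
  and presented_quot_star = star_ideal.quot_star[OF relation_ideal_star_ideal, folded presented_star_algebra_def]
  and presented_quot_hom_lift = star_ideal.quot_hom_lift[OF relation_ideal_star_ideal, folded presented_star_algebra_def]

lemma relations_subset_ideal: "R \<subseteq> relation_ideal R"
  using word.CM.genideal_self[of "R \<union> star free_star_algebra ` R"] by (auto simp: relation_ideal_def)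

text \<open>The universal property of a presented star-algebra: the kernel of a homomorphism that kills the
  relations is an ideal, and it contains the adjoints of the relations too.\<close>

lemma presented_lift:
  assumes T: "star_alg T" and h: "h \<in> star_alg_hom free_star_algebra T"
    and R: "\<And>r. r \<in> R \<Longrightarrow> h r = \<zero>\<^bsub>T\<^esub>"
  obtains g where "g \<in> star_alg_hom (presented_star_algebra R) T"
    "\<And>x. g (relation_ideal R +>\<^bsub>free_star_algebra\<^esub> x) = h x"
proof -
  interpret h: star_hom free_star_algebra T h by (intro star_homI T h word.CM.star_alg_axioms)
  have "relation_ideal R \<subseteq> {x \<in> carrier free_star_algebra. h x = \<zero>\<^bsub>T\<^esub>}"
    unfolding relation_ideal_def
    by (rule word.CM.genideal_minimal[OF h.kernel_ideal]) (auto simp: R h.star)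
  then show thesis using presented_quot_hom_lift[OF T h, of R] that by auto
qed

definition presented_word where
  "presented_word R w = relation_ideal R +>\<^bsub>free_star_algebra\<^esub> Poly_Mapping.single w 1"

lemma presented_carrier: "carrier (presented_star_algebra R) = range ((+>\<^bsub>free_star_algebra\<^esub>) (relation_ideal R))"
  using presented_quot_carrier[of R] by simp

lemma presented_word_closed [simp]: "presented_word R w \<in> carrier (presented_star_algebra R)"
  by (simp add: presented_carrier presented_word_def)

lemma presented_gen_closed [simp]: "presented_gen R g \<in> carrier (presented_star_algebra R)"
  by (simp add: presented_carrier presented_gen_def)

lemma presented_word_Nil: "presented_word R [] = \<one>\<^bsub>presented_star_algebra R\<^esub>"
  using presented_quot_one[of R] by (simp add: presented_word_def word.one_CM word_monoid_def)

lemma presented_word_Cons: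
  "presented_word R ((g, b) # w) = (if b then star (presented_star_algebra R) (presented_gen R g)
     else presented_gen R g) \<otimes>\<^bsub>presented_star_algebra R\<^esub> presented_word R w"
proof -
  have "Poly_Mapping.single ((g, b) # w) 1 =
    (if b then star free_star_algebra (free_gen g) else free_gen g) \<otimes>\<^bsub>free_star_algebra\<^esub> (Poly_Mapping.single w 1)"
    by (simp add: free_gen_def free_mult_single word.star_CM_single word_star_def)
  then show ?thesis
    by (simp add: presented_word_def presented_gen_def presented_quot_mult presented_quot_star split: if_splits)
qed

lemma presented_induct [consumes 1, case_names smult_word add]:
  assumes x: "x \<in> carrier (presented_star_algebra R)"
    and single: "\<And>c w. P (c \<odot>\<^bsub>presented_star_algebra R\<^esub> presented_word R w)"
    and add: "\<And>x y. \<lbrakk>x \<in> carrier (presented_star_algebra R); y \<in> carrier (presented_star_algebra R); P x; P y\<rbrakk>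
      \<Longrightarrow> P (x \<oplus>\<^bsub>presented_star_algebra R\<^esub> y)"
  shows "P x"
proof -
  let ?c = "(+>\<^bsub>free_star_algebra\<^esub>) (relation_ideal R)"
  obtain f where f: "x = ?c f" using x by (auto simp: presented_carrier)
  have s: "P (?c (Poly_Mapping.single w c))" for w c
  proof -
    have "Poly_Mapping.single w c = c \<odot>\<^bsub>free_star_algebra\<^esub> Poly_Mapping.single w 1"
      by (simp add: word.smult_CM_single)
    then have "?c (Poly_Mapping.single w c) = c \<odot>\<^bsub>presented_star_algebra R\<^esub> presented_word R w"
      by (simp only: presented_word_def presented_quot_smult carrier_free UNIV_I)
    then show ?thesis by (simp add: single)
  qed
  have "Poly_Mapping.keys f \<subseteq> UNIV" by simp
  then have "P (?c f)"
  proof (induction f rule: poly_mapping_keys_induct)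
    case zero
    show ?case using s[of "[]" 0] by simp
  next
    case (add f g)
    have "?c (f + g) = ?c f \<oplus>\<^bsub>presented_star_algebra R\<^esub> ?c g"
      by (simp add: presented_quot_add word.add_CM)
    then show ?case using assms(3)[of "?c f" "?c g"] add by (simp add: presented_carrier)
  qed (rule s)
  then show ?thesis by (simp add: f)
qed

lemma presented_word_in_star_subalgebra:
  assumes "star_subalgebra H (presented_star_algebra R)" "\<And>g. presented_gen R g \<in> H"
  shows "presented_word R w \<in> H"
  using star_subalgebraD[OF assms(1)] assms(2)
  by (induction w) (auto simp: presented_word_Nil presented_word_Cons)

text \<open>Applied to the set where two homomorphisms agree, this shows that a homomorphism is determined by
  its values on the generators.\<close>

lemma presented_generated:
  assumes "star_subalgebra H (presented_star_algebra R)" "\<And>g. presented_gen R g \<in> H"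
  shows "H = carrier (presented_star_algebra R)"
proof
  show "carrier (presented_star_algebra R) \<subseteq> H"
  proof
    fix x assume "x \<in> carrier (presented_star_algebra R)"
    then show "x \<in> H"
      by (induction x rule: presented_induct)
        (auto intro: star_subalgebraD[OF assms(1)] presented_word_in_star_subalgebra[OF assms])
  qed
qed (rule star_subalgebraD(1)[OF assms(1)])

section \<open>Tensor products\<close>

locale two_star_algs = S: star_alg S + T: star_alg T
  for S :: "('a, 'y) star_algebra_scheme" and T :: "('b, 'z) star_algebra_scheme"
begin

abbreviation "FT \<equiv> free_tensor S T"
abbreviation "N \<equiv> bilinear_span S T"
abbreviation "ST \<equiv> tensor_algebra S T"
abbreviation "pure \<equiv> pure_tensor S T"

sublocale FT: star_monoid "S \<times>\<times> T" "map_prod (star S) (star T)"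
  rewrites "monoid_star_algebra (S \<times>\<times> T) (map_prod (star S) (star T)) = FT"
proof -
  have "Group.monoid (S \<times>\<times> T)"
    using DirProd_monoid S.monoid_axioms T.monoid_axioms by blast
  then show "star_monoid (S \<times>\<times> T) (map_prod (star S) (star T))"
    by (auto simp: star_monoid_def star_monoid_axioms_def S.star_mult T.star_mult)
qed (simp add: free_tensor_def)

lemma FT_single_closed: "x \<in> carrier S \<Longrightarrow> y \<in> carrier T \<Longrightarrow> Poly_Mapping.single (x, y) c \<in> carrier FT"
  by (rule FT.single_carrier) simp

lemma FT_diff_closed: "f \<in> carrier FT \<Longrightarrow> g \<in> carrier FT \<Longrightarrow> f - g \<in> carrier FT"
  using FT.CM.minus_closed[of f g] by (simp add: FT.minus_CM)

lemma bilinear_relation_cases [consumes 1, case_names left right smult_left smult_right]: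
  assumes "r \<in> bilinear_relations S T"
    and "\<And>x x' y. \<lbrakk>x \<in> carrier S; x' \<in> carrier S; y \<in> carrier T\<rbrakk> \<Longrightarrow>
      P (Poly_Mapping.single (x \<oplus>\<^bsub>S\<^esub> x', y) 1 - Poly_Mapping.single (x, y) 1 - Poly_Mapping.single (x', y) 1)"
    and "\<And>x y y'. \<lbrakk>x \<in> carrier S; y \<in> carrier T; y' \<in> carrier T\<rbrakk> \<Longrightarrow>
      P (Poly_Mapping.single (x, y \<oplus>\<^bsub>T\<^esub> y') 1 - Poly_Mapping.single (x, y) 1 - Poly_Mapping.single (x, y') 1)"
    and "\<And>c x y. \<lbrakk>x \<in> carrier S; y \<in> carrier T\<rbrakk> \<Longrightarrow>
      P (Poly_Mapping.single (c \<odot>\<^bsub>S\<^esub> x, y) 1 - Poly_Mapping.single (x, y) c)"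
    and "\<And>c x y. \<lbrakk>x \<in> carrier S; y \<in> carrier T\<rbrakk> \<Longrightarrow>
      P (Poly_Mapping.single (x, c \<odot>\<^bsub>T\<^esub> y) 1 - Poly_Mapping.single (x, y) c)"
  shows "P r"
  using assms(1) unfolding bilinear_relations_def Let_def
  by (elim UnE CollectE exE conjE) (simp_all add: assms(2-5))

lemma bilinear_relations_mem:
  shows "\<lbrakk>x \<in> carrier S; x' \<in> carrier S; y \<in> carrier T\<rbrakk> \<Longrightarrow>
      Poly_Mapping.single (x \<oplus>\<^bsub>S\<^esub> x', y) 1 - Poly_Mapping.single (x, y) 1 - Poly_Mapping.single (x', y) 1
        \<in> bilinear_relations S T"
    and "\<lbrakk>x \<in> carrier S; y \<in> carrier T; y' \<in> carrier T\<rbrakk> \<Longrightarrow>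
      Poly_Mapping.single (x, y \<oplus>\<^bsub>T\<^esub> y') 1 - Poly_Mapping.single (x, y) 1 - Poly_Mapping.single (x, y') 1
        \<in> bilinear_relations S T"
    and "\<lbrakk>x \<in> carrier S; y \<in> carrier T\<rbrakk> \<Longrightarrow>
      Poly_Mapping.single (c \<odot>\<^bsub>S\<^esub> x, y) 1 - Poly_Mapping.single (x, y) c \<in> bilinear_relations S T"
    and "\<lbrakk>x \<in> carrier S; y \<in> carrier T\<rbrakk> \<Longrightarrow>
      Poly_Mapping.single (x, c \<odot>\<^bsub>T\<^esub> y) 1 - Poly_Mapping.single (x, y) c \<in> bilinear_relations S T"
  unfolding bilinear_relations_def Let_def by blast+

lemma bilinear_relations_closed: "r \<in> bilinear_relations S T \<Longrightarrow> r \<in> carrier FT"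
  by (induction r rule: bilinear_relation_cases) (auto intro!: FT_diff_closed FT_single_closed)

lemma bilinear_span_minimal:
  "submodule K complex_ring FT \<Longrightarrow> bilinear_relations S T \<subseteq> K \<Longrightarrow> N \<subseteq> K"
  by (auto simp: bilinear_span_def)

lemma bilinear_relations_subset: "bilinear_relations S T \<subseteq> N"
  by (auto simp: bilinear_span_def)

lemma bilinear_span_submodule: "submodule N complex_ring FT"
proof -
  have "submodule (carrier FT) complex_ring FT" by (rule FT.CM.submodule_complexI) auto
  then have "N \<subseteq> carrier FT"
    using bilinear_relations_closed by (intro bilinear_span_minimal) auto
  then show ?thesis
    by (rule FT.CM.submodule_complexI) (auto simp: bilinear_span_def dest: submodule_complexD)
qed

lemmas N_closed = submodule_complexD[OF bilinear_span_submodule]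

text \<open>The elements of the span that \<open>F\<close> maps into the span form a submodule. The involution is only
  conjugate-linear, hence the map \<open>d\<close> on scalars.\<close>

lemma bilinear_span_induct:
  assumes f: "f \<in> N"
    and K: "\<And>r. r \<in> bilinear_relations S T \<Longrightarrow> F r \<in> N"
    and F: "\<And>f g. \<lbrakk>f \<in> carrier FT; g \<in> carrier FT\<rbrakk> \<Longrightarrow> F (f + g) = F f + F g"
    "\<And>c f. f \<in> carrier FT \<Longrightarrow> F (c \<odot>\<^bsub>FT\<^esub> f) = d c \<odot>\<^bsub>FT\<^esub> F f" "F 0 = 0"
  shows "F f \<in> N"
proof -
  have "N \<subseteq> {f \<in> carrier FT. F f \<in> N}"
  proof (rule bilinear_span_minimal)
    show "submodule {f \<in> carrier FT. F f \<in> N} complex_ring FT"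
      by (rule FT.CM.submodule_complexI)
        (auto simp: F FT.add_CM FT.zero_CM N_closed intro: FT.carrier_add FT.zero_carrier
          N_closed(3)[unfolded FT.add_CM] N_closed(2)[unfolded FT.zero_CM])
  qed (use K bilinear_relations_closed in auto)
  then show ?thesis using f by auto
qed

text \<open>A pair times a bilinearity relation is a bilinearity relation, as multiplication in each factor
  is bilinear.\<close>

lemma bilinear_span_mult_single:
  assumes f: "f \<in> N" and z: "z \<in> carrier S" "w \<in> carrier T"
  shows "Poly_Mapping.single (z, w) 1 \<otimes>\<^bsub>FT\<^esub> f \<in> N" "f \<otimes>\<^bsub>FT\<^esub> Poly_Mapping.single (z, w) 1 \<in> N"
proof -
  note simps = FT.mult_CM_add_right FT.mult_CM_add_left FT.mult_CM_diff_left FT.mult_CM_diff_right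
    FT.mult_CM_single FT.mult_CM_zero FT.CM.smult_mult_l FT.CM.smult_mult_r FT_single_closed z
  note distr = S.r_distr S.l_distr T.r_distr T.l_distr S.smult_mult_l S.smult_mult_r T.smult_mult_l T.smult_mult_r
  note mem = bilinear_relations_subset[THEN subsetD] bilinear_relations_mem
  show "Poly_Mapping.single (z, w) 1 \<otimes>\<^bsub>FT\<^esub> f \<in> N"
  proof (rule bilinear_span_induct[OF f, where d = "\<lambda>c. c"])
    fix r assume "r \<in> bilinear_relations S T"
    then show "Poly_Mapping.single (z, w) 1 \<otimes>\<^bsub>FT\<^esub> r \<in> N"
      by (induction r rule: bilinear_relation_cases) (use z in \<open>auto simp: simps distr intro!: mem\<close>)
  qed (auto simp: simps)
  show "f \<otimes>\<^bsub>FT\<^esub> Poly_Mapping.single (z, w) 1 \<in> N"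
  proof (rule bilinear_span_induct[OF f, where d = "\<lambda>c. c"])
    fix r assume "r \<in> bilinear_relations S T"
    then show "r \<otimes>\<^bsub>FT\<^esub> Poly_Mapping.single (z, w) 1 \<in> N"
      by (induction r rule: bilinear_relation_cases) (use z in \<open>auto simp: simps distr intro!: mem\<close>)
  qed (auto simp: simps)
qed

lemma bilinear_span_mult:
  assumes f: "f \<in> N" and g: "g \<in> carrier FT"
  shows "g \<otimes>\<^bsub>FT\<^esub> f \<in> N" "f \<otimes>\<^bsub>FT\<^esub> g \<in> N"
proof -
  have fc: "f \<in> carrier FT" using f N_closed(1) by auto
  have "g \<otimes>\<^bsub>FT\<^esub> f \<in> N \<and> f \<otimes>\<^bsub>FT\<^esub> g \<in> N"
    using g
  proof (induction g rule: FT.CM_induct)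
    case zero
    then show ?case using N_closed(2) by (simp add: FT.mult_CM_zero FT.zero_CM)
  next
    case (single s c)
    obtain z w where s: "s = (z, w)" by force
    have "Poly_Mapping.single s c = c \<odot>\<^bsub>FT\<^esub> Poly_Mapping.single (z, w) 1"
      by (simp add: FT.smult_CM_single s)
    then show ?case
      using bilinear_span_mult_single[OF f, of z w] single fc
      by (auto simp: s FT.CM.smult_mult_l FT.CM.smult_mult_r FT_single_closed intro!: N_closed(4))
  next
    case (add g h)
    then show ?case using N_closed(3) by (simp add: FT.mult_CM_add_left FT.mult_CM_add_right FT.add_CM)
  qed
  then show "g \<otimes>\<^bsub>FT\<^esub> f \<in> N" "f \<otimes>\<^bsub>FT\<^esub> g \<in> N" by auto
qed

lemma bilinear_span_star:
  assumes f: "f \<in> N"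
  shows "star FT f \<in> N"
proof (rule bilinear_span_induct[OF f, where d = cnj])
  note mem = bilinear_relations_subset[THEN subsetD] bilinear_relations_mem
  fix r assume "r \<in> bilinear_relations S T"
  then show "star FT r \<in> N"
    by (induction r rule: bilinear_relation_cases)
      (auto simp: FT.star_CM_diff FT.star_CM_single S.star_add S.star_smult T.star_add T.star_smult intro!: mem)
qed (auto simp: FT.star_CM_add FT.CM.star_smult FT.star_CM_zero)

lemma bilinear_span_star_ideal: "star_ideal FT N"
proof -
  have "ideal N FT"
    by (rule idealI) (auto simp: FT.CM.ring_axioms N_closed(5) bilinear_span_mult)
  then show ?thesis
    by (simp add: star_ideal_def star_ideal_axioms_def FT.CM.star_alg_axioms bilinear_span_star)
qed

sublocale ST: star_ideal FT N
  rewrites "quot_star_algebra FT N = ST"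
  by (rule bilinear_span_star_ideal) (simp add: tensor_algebra_def)

lemma pure_closed [simp]: "x \<in> carrier S \<Longrightarrow> y \<in> carrier T \<Longrightarrow> pure x y \<in> carrier ST"
  by (auto simp: pure_tensor_def FT_single_closed)

lemma pure_mult:
  "\<lbrakk>x \<in> carrier S; x' \<in> carrier S; y \<in> carrier T; y' \<in> carrier T\<rbrakk> \<Longrightarrow>
    pure x y \<otimes>\<^bsub>ST\<^esub> pure x' y' = pure (x \<otimes>\<^bsub>S\<^esub> x') (y \<otimes>\<^bsub>T\<^esub> y')"
  by (simp add: pure_tensor_def ST.quot_mult FT_single_closed FT.mult_CM_single)

lemma pure_star:
  "\<lbrakk>x \<in> carrier S; y \<in> carrier T\<rbrakk> \<Longrightarrow> star ST (pure x y) = pure (star S x) (star T y)"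
  by (simp add: pure_tensor_def ST.quot_star FT_single_closed FT.star_CM_single)

lemma pure_one: "\<one>\<^bsub>ST\<^esub> = pure \<one>\<^bsub>S\<^esub> \<one>\<^bsub>T\<^esub>"
  by (simp add: pure_tensor_def ST.quot_one FT.one_CM)

lemma pure_bilinear:
  shows pure_add_left: "\<lbrakk>x \<in> carrier S; x' \<in> carrier S; y \<in> carrier T\<rbrakk> \<Longrightarrow>
      pure (x \<oplus>\<^bsub>S\<^esub> x') y = pure x y \<oplus>\<^bsub>ST\<^esub> pure x' y"
    and pure_add_right: "\<lbrakk>x \<in> carrier S; y \<in> carrier T; y' \<in> carrier T\<rbrakk> \<Longrightarrow>
      pure x (y \<oplus>\<^bsub>T\<^esub> y') = pure x y \<oplus>\<^bsub>ST\<^esub> pure x y'"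
    and pure_smult_left: "\<lbrakk>x \<in> carrier S; y \<in> carrier T\<rbrakk> \<Longrightarrow> pure (c \<odot>\<^bsub>S\<^esub> x) y = c \<odot>\<^bsub>ST\<^esub> pure x y"
    and pure_smult_right: "\<lbrakk>x \<in> carrier S; y \<in> carrier T\<rbrakk> \<Longrightarrow> pure x (c \<odot>\<^bsub>T\<^esub> y) = c \<odot>\<^bsub>ST\<^esub> pure x y"
proof -
  have eq: "N +>\<^bsub>FT\<^esub> f = N +>\<^bsub>FT\<^esub> g" if "f - g \<in> bilinear_relations S T" "f \<in> carrier FT" "g \<in> carrier FT" for f g
    using that bilinear_relations_subset by (auto simp: ST.coset_eq_iff FT.minus_CM)
  note simps = pure_tensor_def ST.quot_add ST.quot_smult FT_single_closed FT.add_CM FT.smult_CM_single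
    FT.carrier_add diff_diff_eq[symmetric] bilinear_relations_mem
  show "\<lbrakk>x \<in> carrier S; x' \<in> carrier S; y \<in> carrier T\<rbrakk> \<Longrightarrow>
      pure (x \<oplus>\<^bsub>S\<^esub> x') y = pure x y \<oplus>\<^bsub>ST\<^esub> pure x' y"
    "\<lbrakk>x \<in> carrier S; y \<in> carrier T; y' \<in> carrier T\<rbrakk> \<Longrightarrow>
      pure x (y \<oplus>\<^bsub>T\<^esub> y') = pure x y \<oplus>\<^bsub>ST\<^esub> pure x y'"
    "\<lbrakk>x \<in> carrier S; y \<in> carrier T\<rbrakk> \<Longrightarrow> pure (c \<odot>\<^bsub>S\<^esub> x) y = c \<odot>\<^bsub>ST\<^esub> pure x y"
    "\<lbrakk>x \<in> carrier S; y \<in> carrier T\<rbrakk> \<Longrightarrow> pure x (c \<odot>\<^bsub>T\<^esub> y) = c \<odot>\<^bsub>ST\<^esub> pure x y"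
    by (simp_all add: simps eq)
qed

text \<open>The universal property of the tensor product. A bilinear map extends linearly to
  the free vector space on pairs, and bilinearity says that the extension kills the relations.\<close>

lemma tensor_lift:
  fixes V :: "('v, 'w) star_algebra_scheme" and \<beta> :: "'a \<Rightarrow> 'b \<Rightarrow> 'v"
  assumes V: "star_alg V"
    and closed: "\<And>x y. \<lbrakk>x \<in> carrier S; y \<in> carrier T\<rbrakk> \<Longrightarrow> \<beta> x y \<in> carrier V"
    and add_left: "\<And>x x' y. \<lbrakk>x \<in> carrier S; x' \<in> carrier S; y \<in> carrier T\<rbrakk> \<Longrightarrow>
      \<beta> (x \<oplus>\<^bsub>S\<^esub> x') y = \<beta> x y \<oplus>\<^bsub>V\<^esub> \<beta> x' y"
    and add_right: "\<And>x y y'. \<lbrakk>x \<in> carrier S; y \<in> carrier T; y' \<in> carrier T\<rbrakk> \<Longrightarrow>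
      \<beta> x (y \<oplus>\<^bsub>T\<^esub> y') = \<beta> x y \<oplus>\<^bsub>V\<^esub> \<beta> x y'"
    and smult_left: "\<And>c x y. \<lbrakk>x \<in> carrier S; y \<in> carrier T\<rbrakk> \<Longrightarrow> \<beta> (c \<odot>\<^bsub>S\<^esub> x) y = c \<odot>\<^bsub>V\<^esub> \<beta> x y"
    and smult_right: "\<And>c x y. \<lbrakk>x \<in> carrier S; y \<in> carrier T\<rbrakk> \<Longrightarrow> \<beta> x (c \<odot>\<^bsub>T\<^esub> y) = c \<odot>\<^bsub>V\<^esub> \<beta> x y"
  obtains L where "\<And>x y. \<lbrakk>x \<in> carrier S; y \<in> carrier T\<rbrakk> \<Longrightarrow> L (pure x y) = \<beta> x y"
    "\<And>s t. \<lbrakk>s \<in> carrier ST; t \<in> carrier ST\<rbrakk> \<Longrightarrow> L (s \<oplus>\<^bsub>ST\<^esub> t) = L s \<oplus>\<^bsub>V\<^esub> L t"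
    "\<And>c s. s \<in> carrier ST \<Longrightarrow> L (c \<odot>\<^bsub>ST\<^esub> s) = c \<odot>\<^bsub>V\<^esub> L s"
proof -
  interpret V: star_alg V by (rule V)
  define F where "F = linear_extension V (\<lambda>(x, y). \<beta> x y)"
  have \<beta>: "(\<lambda>(x, y). \<beta> x y) \<in> carrier (S \<times>\<times> T) \<rightarrow> carrier V" using closed by auto
  note F_add = FT.linear_extension_CM_add[OF V \<beta>, folded F_def]
    and F_closed = FT.linear_extension_CM_closed[OF V \<beta>, folded F_def]
    and F_smult = FT.linear_extension_CM_smult[OF V \<beta>, folded F_def]
  have F_single: "F (Poly_Mapping.single (x, y) c) = c \<odot>\<^bsub>V\<^esub> \<beta> x y"
    if "x \<in> carrier S" "y \<in> carrier T" for x y c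
    using FT.linear_extension_CM_single[OF V \<beta>, of "(x, y)"] that by (simp add: F_def)
  have F_diff: "F (f - g) = F f \<ominus>\<^bsub>V\<^esub> F g" if "f \<in> carrier FT" "g \<in> carrier FT" for f g
  proof -
    have "f - g = f + (-1) \<odot>\<^bsub>FT\<^esub> g"
      using that FT.CM.minus_eq_smult[of f g] by (simp add: FT.minus_CM FT.add_CM)
    then have "F (f - g) = F (f + (-1) \<odot>\<^bsub>FT\<^esub> g)" by (rule arg_cong)
    also have "\<dots> = F f \<ominus>\<^bsub>V\<^esub> F g"
      using that by (simp add: F_add F_smult F_closed V.minus_eq_smult)
    finally show ?thesis .
  qed
  \<comment> \<open>the two steps of subtraction in an additivity relation cancel\<close>
  have aux: "(u \<oplus>\<^bsub>V\<^esub> v) \<ominus>\<^bsub>V\<^esub> u \<ominus>\<^bsub>V\<^esub> v = \<zero>\<^bsub>V\<^esub>" if "u \<in> carrier V" "v \<in> carrier V" for u v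
    using that V.r_neg[of "u \<oplus>\<^bsub>V\<^esub> v"] by (simp add: V.minus_eq V.a_assoc V.minus_add)
  have kernel: "N \<subseteq> {f \<in> carrier FT. F f = \<zero>\<^bsub>V\<^esub>}"
  proof (rule bilinear_span_minimal)
    show "submodule {f \<in> carrier FT. F f = \<zero>\<^bsub>V\<^esub>} complex_ring FT"
      by (rule FT.CM.submodule_complexI)
        (auto simp: FT.add_CM FT.zero_CM F_add F_smult intro: FT.carrier_add FT.zero_carrier, simp add: F_def)
    have "r \<in> carrier FT \<and> F r = \<zero>\<^bsub>V\<^esub>" if "r \<in> bilinear_relations S T" for r
    proof
      show "F r = \<zero>\<^bsub>V\<^esub>"
        using that
        by (induction r rule: bilinear_relation_cases)
          (auto simp: F_diff F_single FT_single_closed FT_diff_closed closed add_left add_right smult_left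
            smult_right aux V.minus_eq_zero_iff)
    qed (use that bilinear_relations_closed in auto)
    then show "bilinear_relations S T \<subseteq> {f \<in> carrier FT. F f = \<zero>\<^bsub>V\<^esub>}" by auto
  qed
  have "F f = F g" if "f \<in> carrier FT" "g \<in> carrier FT" "f \<ominus>\<^bsub>FT\<^esub> g \<in> N" for f g
  proof -
    have "f - g \<in> N" using that by (simp add: FT.minus_CM)
    then have "F (f - g) = \<zero>\<^bsub>V\<^esub>" using kernel by blast
    then have "F f \<ominus>\<^bsub>V\<^esub> F g = \<zero>\<^bsub>V\<^esub>" using F_diff that by simp
    then show ?thesis using V.minus_eq_zero_iff F_closed that by blast
  qed
  then obtain L where L: "\<And>f. f \<in> carrier FT \<Longrightarrow> L (N +>\<^bsub>FT\<^esub> f) = F f"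
    using ST.quot_lift[of F] by metis
  show thesis
  proof (rule that)
    show "L (pure x y) = \<beta> x y" if "x \<in> carrier S" "y \<in> carrier T" for x y
      using that by (simp add: pure_tensor_def L FT_single_closed F_single closed)
  qed (auto simp: ST.quot_carrier ST.quot_add ST.quot_smult FT.add_CM FT.carrier_add L F_add F_smult)
qed

end

section \<open>Ordered products and commutation up to a scalar\<close>

context star_alg
begin

lemma ordered_prod_closed [simp]:
  "(\<And>i. f i \<in> carrier S) \<Longrightarrow> ordered_prod S f n \<in> carrier S"
proof -
  assume f: "\<And>i. f i \<in> carrier S"
  have "foldr (\<otimes>) (map f is) \<one> \<in> carrier S" for "is" by (induction "is") (auto simp: f)
  then show ?thesis by (simp add: ordered_prod_def)
qed

lemma ordered_prod_0 [simp]: "ordered_prod S f 0 = \<one>"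
  by (simp add: ordered_prod_def)

lemma ordered_prod_Suc:
  assumes f: "\<And>i. f i \<in> carrier S"
  shows "ordered_prod S f (Suc n) = ordered_prod S f n \<otimes> f (Suc n)"
proof -
  have cl: "foldr (\<otimes>) (map f is) \<one> \<in> carrier S" for "is" by (induction "is") (auto simp: f)
  have "foldr (\<otimes>) (map f is) y = foldr (\<otimes>) (map f is) \<one> \<otimes> y" if "y \<in> carrier S" for "is" y
    using that by (induction "is") (auto simp: f cl m_assoc)
  from this[of "f (Suc n)" "[1..<Suc n]"] show ?thesis
    by (simp add: ordered_prod_def f)
qed

lemma ordered_prod_Suc_left:
  "ordered_prod S f (Suc n) = f 1 \<otimes> ordered_prod S (\<lambda>i. f (Suc i)) n"
proof -
  have "[1..<Suc (Suc n)] = 1 # map Suc [1..<Suc n]"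
    by (subst upt_conv_Cons) (auto simp: map_Suc_upt)
  then show ?thesis by (simp add: ordered_prod_def o_def del: upt_Suc)
qed

text \<open>The four generators commute in this sense, with a phase as scalar, and so do \<open>A\<close> and \<open>B\<close> with
  each generator, with a power of \<open>p\<close> or \<open>q\<close> as scalar.\<close>

definition skew_commute :: "'a \<Rightarrow> 'a \<Rightarrow> complex \<Rightarrow> bool" where
  "skew_commute x y c \<longleftrightarrow> x \<otimes> y = c \<odot> (y \<otimes> x)"

lemma skew_commute_mult_right:
  assumes "x \<in> carrier S" "y \<in> carrier S" "z \<in> carrier S" "skew_commute x y c" "skew_commute x z d"
  shows "skew_commute x (y \<otimes> z) (c * d)"
proof -
  have "x \<otimes> (y \<otimes> z) = (x \<otimes> y) \<otimes> z" using assms by (simp add: m_assoc)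
  also have "\<dots> = c \<odot> (y \<otimes> (x \<otimes> z))"
    using assms by (simp add: skew_commute_def m_assoc smult_mult_l)
  also have "\<dots> = (c * d) \<odot> (y \<otimes> z \<otimes> x)"
    using assms by (simp add: skew_commute_def m_assoc smult_mult_r smult_smult)
  finally show ?thesis by (simp add: skew_commute_def)
qed

lemma skew_commute_mult_left:
  assumes "x \<in> carrier S" "y \<in> carrier S" "z \<in> carrier S" "skew_commute x z c" "skew_commute y z d"
  shows "skew_commute (x \<otimes> y) z (c * d)"
proof -
  have "x \<otimes> y \<otimes> z = d \<odot> (x \<otimes> z \<otimes> y)"
    using assms by (simp add: m_assoc) (simp add: skew_commute_def smult_mult_r m_assoc[symmetric])
  also have "\<dots> = (c * d) \<odot> (z \<otimes> (x \<otimes> y))"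
    using assms by (simp add: skew_commute_def m_assoc smult_mult_l smult_smult mult.commute)
  finally show ?thesis by (simp add: skew_commute_def)
qed

lemma skew_commute_minus:
  "\<lbrakk>x \<in> carrier S; y \<in> carrier S; z \<in> carrier S; skew_commute x z c; skew_commute y z c\<rbrakk>
    \<Longrightarrow> skew_commute (x \<ominus> y) z c"
  by (simp add: skew_commute_def minus_mult_l minus_mult_r smult_minus)

lemma skew_commute_one: "z \<in> carrier S \<Longrightarrow> skew_commute \<one> z 1"
  by (simp add: skew_commute_def)

lemma skew_commute_pow_right:
  assumes "x \<in> carrier S" "y \<in> carrier S" "skew_commute x y c"
  shows "skew_commute x (y [^] (n::nat)) (c ^ n)"
proof (induction n)
  case (Suc n)
  then show ?case using skew_commute_mult_right[OF _ _ _ Suc assms(3)] assms by (simp add: mult.commute)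
qed (use assms in \<open>simp add: skew_commute_def\<close>)

lemma skew_commute_pow_left:
  assumes "x \<in> carrier S" "y \<in> carrier S" "skew_commute x y c"
  shows "skew_commute (x [^] (n::nat)) y (c ^ n)"
proof (induction n)
  case (Suc n)
  then show ?case using skew_commute_mult_left[OF _ _ _ Suc assms(3)] assms by (simp add: mult.commute)
qed (use assms in \<open>simp add: skew_commute_def\<close>)

lemma skew_commute_sym:
  "\<lbrakk>x \<in> carrier S; y \<in> carrier S; skew_commute x y c; c \<noteq> 0\<rbrakk> \<Longrightarrow> skew_commute y x (inverse c)"
  by (simp add: skew_commute_def smult_smult)

lemma skew_commute_star:
  assumes "x \<in> carrier S" "y \<in> carrier S" "skew_commute x y c"
  shows "skew_commute (star S y) (star S x) (cnj c)"
proof -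
  have "star S (x \<otimes> y) = star S (c \<odot> (y \<otimes> x))" using assms by (simp add: skew_commute_def)
  then show ?thesis using assms by (simp add: skew_commute_def star_mult star_smult)
qed

lemma skew_commute_one_minus:
  assumes "Z \<in> carrier S" "x \<in> carrier S" "skew_commute Z x s"
  shows "(\<one> \<ominus> c \<odot> Z) \<otimes> x = x \<otimes> (\<one> \<ominus> (c * s) \<odot> Z)"
  using assms by (simp add: skew_commute_def minus_mult_l minus_mult_r smult_mult_l smult_mult_r smult_smult)

lemma ordered_prod_absorb:
  assumes "\<And>i. f i \<in> carrier S" "y \<in> carrier S" "\<And>i. f i \<otimes> y = y"
  shows "ordered_prod S f n \<otimes> y = y"
  using assms by (induction n) (auto simp: ordered_prod_Suc m_assoc)

lemma ordered_prod_skew: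
  assumes "\<And>i. f i \<in> carrier S" "x \<in> carrier S" "\<And>i. skew_commute (f i) x 1"
  shows "skew_commute (ordered_prod S f n) x 1"
proof (induction n)
  case 0 show ?case using assms by (simp add: skew_commute_one)
next
  case (Suc n)
  then show ?case using skew_commute_mult_left[OF _ _ _ Suc assms(3)] assms(1,2) by (simp add: ordered_prod_Suc)
qed

text \<open>If \<open>P y = y\<close> then \<open>P (1 - c y) = P - c y\<close>, so multiplying \<open>P + Q - 1\<close> by \<open>1 - c y\<close> replaces \<open>Q\<close> by
  \<open>Q (1 - c y)\<close> and changes nothing else.\<close>

lemma prod_eq_sum_minus_one:
  assumes P: "P \<in> carrier S" and f: "\<And>i. f i = \<one> \<ominus> c i \<odot> y" and y: "y \<in> carrier S" "P \<otimes> y = y"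
  shows "P \<otimes> ordered_prod S f n = P \<oplus> ordered_prod S f n \<ominus> \<one>"
proof -
  have cl: "f i \<in> carrier S" for i using y by (simp add: f)
  have aux: "(u \<oplus> v) \<ominus> v = u" if "u \<in> carrier S" "v \<in> carrier S" for u v
    using that by (simp add: minus_eq a_assoc r_neg)
  show ?thesis
  proof (induction n)
    case 0 show ?case using P by (simp add: aux)
  next
    case (Suc n)
    let ?Q = "ordered_prod S f n"
    have Q: "?Q \<in> carrier S" using cl by simp
    have Pf: "P \<otimes> f i = P \<ominus> c i \<odot> y" for i
      using P y by (simp add: f minus_mult_r smult_mult_r)
    have "P \<otimes> ordered_prod S f (Suc n) = (P \<otimes> ?Q) \<otimes> f (Suc n)"
      using P Q cl by (simp add: ordered_prod_Suc m_assoc)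
    also have "\<dots> = (P \<ominus> c (Suc n) \<odot> y) \<oplus> ?Q \<otimes> f (Suc n) \<ominus> (\<one> \<ominus> c (Suc n) \<odot> y)"
      using P Q cl by (simp add: Suc minus_mult_l l_distr Pf) (simp add: f)
    also have "\<dots> = P \<oplus> ?Q \<otimes> f (Suc n) \<ominus> \<one>"
    proof -
      have "(u \<ominus> v) \<oplus> w \<ominus> (x \<ominus> v) = u \<oplus> w \<ominus> x"
        if "u \<in> carrier S" "v \<in> carrier S" "w \<in> carrier S" "x \<in> carrier S" for u v w x
        using that by algebra
      then show ?thesis using P Q cl y by simp
    qed
    finally show ?case using cl by (simp add: ordered_prod_Suc)
  qed
qed

text \<open>For a unitary element this is the ordinary integer power.\<close>
definition star_power :: "'a \<Rightarrow> int \<Rightarrow> 'a" where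
  "star_power x n = (if n \<ge> 0 then x [^] nat n else star S x [^] nat \<bar>n\<bar>)"

lemma star_power_closed [simp, intro]: "x \<in> carrier S \<Longrightarrow> star_power x n \<in> carrier S"
  by (auto simp: star_power_def)

lemma star_power_0 [simp]: "star_power x 0 = \<one>"
  by (simp add: star_power_def)

lemma star_star_power: "x \<in> carrier S \<Longrightarrow> star S (star_power x n) = star_power x (- n)"
  by (auto simp: star_power_def star_pow)

lemma star_power_Suc: "x \<in> carrier S \<Longrightarrow> n \<ge> 0 \<Longrightarrow> star_power x (n + 1) = star_power x n \<otimes> x"
  by (simp add: star_power_def nat_add_distrib)

lemma star_power_pred:
  assumes "x \<in> carrier S" "n \<le> 0" shows "star_power x (n - 1) = star_power x n \<otimes> star S x"
proof -
  have *: "nat \<bar>n - 1\<bar> = Suc (nat \<bar>n\<bar>)" using assms by simp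
  show ?thesis unfolding star_power_def * using assms by auto
qed

lemma star_power_add_nonneg:
  "x \<in> carrier S \<Longrightarrow> m \<ge> 0 \<Longrightarrow> n \<ge> 0 \<Longrightarrow> star_power x (m + n) = star_power x m \<otimes> star_power x n"
  by (simp add: star_power_def nat_add_distrib nat_pow_mult)

lemma star_power_add_nonpos:
  assumes "x \<in> carrier S" "m \<le> 0" "n \<le> 0"
  shows "star_power x (m + n) = star_power x m \<otimes> star_power x n"
proof -
  have "star_power x (m + n) = star S (star_power x (- n + - m))"
    using assms by (simp add: star_star_power add.commute)
  also have "\<dots> = star_power x m \<otimes> star_power x n"
    using assms by (subst star_power_add_nonneg) (auto simp: star_mult star_star_power)
  finally show ?thesis .
qed

text \<open>For a unitary element negative powers are inverses, so the exponents add for all signs.\<close>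

lemma unitary_star_power_add:
  assumes u: "u \<in> carrier S" "u \<otimes> star S u = \<one>" "star S u \<otimes> u = \<one>"
  shows "star_power u (m + n) = star_power u m \<otimes> star_power u n"
proof -
  have suc: "star_power u (n + 1) = star_power u n \<otimes> u" for n
  proof (cases "n \<ge> 0")
    case False
    then show ?thesis using star_power_pred[of u "n + 1"] u by (simp add: m_assoc)
  qed (use u in \<open>simp add: star_power_Suc\<close>)
  have pred: "star_power u (n - 1) = star_power u n \<otimes> star S u" for n
    using suc[of "n - 1"] u by (simp add: m_assoc)
  show ?thesis
  proof (induction n rule: int_induct[where k = 0])
    case (step1 i)
    then show ?case using suc[of "m + i"] suc[of i] u by (simp add: m_assoc add.assoc)
  next
    case (step2 i)
    then show ?case using pred[of "m + i"] pred[of i] u by (simp add: m_assoc add_diff_eq)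
  qed (use u in simp)
qed

lemma skew_commute_star_power:
  assumes "x \<in> carrier S" "y \<in> carrier S" "skew_commute y x c" "skew_commute y (star S x) d"
  obtains e where "skew_commute y (star_power x n) e"
  using skew_commute_pow_right[OF assms(2) assms(1) assms(3), of "nat n"]
    skew_commute_pow_right[OF assms(2) star_closed[OF assms(1)] assms(4), of "nat \<bar>n\<bar>"]
  by (cases "n \<ge> 0") (auto simp: star_power_def)

end

lemma (in star_hom) star_power:
  "x \<in> carrier S \<Longrightarrow> h (S.star_power x n) = T.star_power (h x) n"
  by (simp add: S.star_power_def T.star_power_def pow star)

section \<open>Quantum discs\<close>

text \<open>The relation \<open>z\<^sup>*z - r zz\<^sup>* = 1 - r\<close> of the quantum disc, which both \<open>a\<close> and \<open>b\<close> satisfy. The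
  element \<open>Z\<close> becomes \<open>A\<close> or \<open>B\<close>.\<close>

locale quantum_disc = star_alg S for S :: "('a, 'y) star_algebra_scheme" (structure) +
  fixes z :: 'a and r :: real
  assumes z_closed [simp, intro]: "z \<in> carrier S" and r_pos: "r > 0"
    and disc_relation: "((star S z \<otimes> z) \<ominus> (of_real r \<odot> (z \<otimes> star S z))) \<ominus> (of_real (1 - r) \<odot> \<one>) = \<zero>"
begin

definition Z where "Z = \<one> \<ominus> z \<otimes> star S z"

lemma Z_closed [simp, intro]: "Z \<in> carrier S" by (simp add: Z_def)

lemma star_Z [simp]: "star S Z = Z" by (simp add: Z_def star_minus star_mult)

lemma z_star_z: "z \<otimes> star S z = \<one> \<ominus> Z"
proof -
  have "\<one> \<ominus> (\<one> \<ominus> x) = x" if "x \<in> carrier S" for x using that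
    by (simp add: minus_eq minus_add a_assoc[symmetric] r_neg)
  then show ?thesis by (simp add: Z_def)
qed

lemma star_z_z: "star S z \<otimes> z = \<one> \<ominus> of_real r \<odot> Z"
proof -
  have "star S z \<otimes> z \<ominus> of_real r \<odot> (z \<otimes> star S z) = of_real (1 - r) \<odot> \<one>"
    using disc_relation by (subst (asm) minus_eq_zero_iff) auto
  then have "star S z \<otimes> z = of_real (1 - r) \<odot> \<one> \<oplus> of_real r \<odot> (z \<otimes> star S z)"
    by (metis disc_relation a_minus_def add.inv_solve_right' add.m_closed m_closed minus_closed one_closed
        smult_closed star_closed z_closed)
  also have "\<dots> = (of_real (1 - r) \<odot> \<one> \<oplus> of_real r \<odot> \<one>) \<oplus> (- of_real r) \<odot> Z"
    by (simp add: z_star_z minus_eq_smult smult_r_distr smult_smult a_assoc)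
  also have "of_real (1 - r) \<odot> \<one> \<oplus> of_real r \<odot> \<one> = \<one>"
    using smult_l_distr[of \<one> "of_real (1 - r)" "of_real r"] by simp
  finally show ?thesis by (simp add: minus_eq_smult smult_smult)
qed

text \<open>\<open>Zz = z - z(z\<^sup>*z) = z - z(1 - rZ) = r zZ\<close>.\<close>

lemma Z_z: "skew_commute Z z (of_real r)"
proof -
  have "Z \<otimes> z = z \<ominus> z \<otimes> (star S z \<otimes> z)"
    by (simp add: Z_def minus_mult_l m_assoc)
  also have "\<dots> = z \<ominus> (z \<ominus> of_real r \<odot> (z \<otimes> Z))"
    by (simp add: star_z_z minus_mult_r smult_mult_r)
  also have "\<dots> = of_real r \<odot> (z \<otimes> Z)"
    by (simp add: minus_eq minus_add a_assoc[symmetric] r_neg)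
  finally show ?thesis by (simp add: skew_commute_def)
qed

lemma Z_star_z: "skew_commute Z (star S z) (inverse (of_real r))"
  using skew_commute_sym[OF _ _ skew_commute_star[OF _ _ Z_z]] r_pos by simp

lemma Z_star_power: "skew_commute Z (star_power z n) (of_real (r powi n))"
  using skew_commute_pow_right[OF _ _ Z_z, of "nat n"] skew_commute_pow_right[OF _ _ Z_star_z, of "nat \<bar>n\<bar>"]
  by (cases "n \<ge> 0") (auto simp: star_power_def power_int_def)

text \<open>The exponent moves by one, at the cost of a linear factor in \<open>Z\<close> if a \<open>z\<^sup>*z\<close> is cancelled.\<close>

lemma star_power_mult_z: "\<exists>c. star_power z n \<otimes> z = star_power z (n + 1) \<otimes> (\<one> \<ominus> c \<odot> Z)"
proof (cases "n \<ge> 0")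
  case True
  then show ?thesis by (intro exI[of _ 0]) (simp add: star_power_Suc minus_eq)
next
  case False
  then have "star_power z n = star_power z (n + 1) \<otimes> star S z"
    using star_power_pred[of z "n + 1"] by simp
  then show ?thesis by (intro exI[of _ "of_real r"]) (simp add: m_assoc star_z_z)
qed

lemma star_power_mult_star_z: "\<exists>c. star_power z n \<otimes> star S z = star_power z (n - 1) \<otimes> (\<one> \<ominus> c \<odot> Z)"
proof (cases "n \<le> 0")
  case True
  then show ?thesis by (intro exI[of _ 0]) (simp add: star_power_pred minus_eq)
next
  case False
  then have "star_power z n = star_power z (n - 1) \<otimes> z"
    using star_power_Suc[of z "n - 1"] by simp
  then show ?thesis by (intro exI[of _ 1]) (simp add: m_assoc z_star_z)
qed

definition factor where "factor n = \<one> \<ominus> of_real (r powi n) \<odot> Z"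

lemma factor_closed [simp, intro]: "factor n \<in> carrier S" by (simp add: factor_def)

text \<open>The innermost \<open>z\<^sup>*z = 1 - rZ\<close> is moved to the right past \<open>z\<^sup>n\<close>, where it becomes the last factor
  of the product.\<close>

lemma star_pow_mult_pow: "star S z [^] n \<otimes> z [^] n = ordered_prod S (\<lambda>i. factor (int i)) n"
proof (induction n)
  case (Suc n)
  have "star S z [^] Suc n \<otimes> z [^] Suc n = star S z [^] n \<otimes> ((star S z \<otimes> z) \<otimes> z [^] n)"
    unfolding nat_pow_Suc2[OF z_closed] by (simp add: m_assoc)
  also have "(star S z \<otimes> z) \<otimes> z [^] n = z [^] n \<otimes> factor (int (Suc n))"
    unfolding star_z_z factor_def
    by (subst skew_commute_one_minus[OF _ _ skew_commute_pow_right[OF _ _ Z_z]]) (auto simp: add.commute power_int_def nat_add_distrib)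
  also have "star S z [^] n \<otimes> (z [^] n \<otimes> factor (int (Suc n))) = ordered_prod S (\<lambda>i. factor (int i)) (Suc n)"
    using Suc by (subst ordered_prod_Suc) (auto simp: m_assoc[symmetric])
  finally show ?case .
qed simp

text \<open>The innermost \<open>zz\<^sup>* = 1 - Z\<close> is moved to the left past \<open>z\<^sup>n\<close>, where it becomes the first factor
  of the product.\<close>

lemma pow_mult_star_pow: "z [^] n \<otimes> star S z [^] n = ordered_prod S (\<lambda>i. factor (int i - int n)) n"
proof (induction n)
  case (Suc n)
  have "z [^] Suc n \<otimes> star S z [^] Suc n = (z [^] n \<otimes> (z \<otimes> star S z)) \<otimes> star S z [^] n"
    unfolding nat_pow_Suc2[OF star_closed[OF z_closed]] by (simp add: m_assoc)
  also have "z [^] n \<otimes> (z \<otimes> star S z) = factor (- int n) \<otimes> z [^] n"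
    unfolding z_star_z factor_def using r_pos
    by (subst skew_commute_one_minus[OF _ _ skew_commute_pow_right[OF _ _ Z_z]]) (auto simp: power_int_minus)
  also have "factor (- int n) \<otimes> z [^] n \<otimes> star S z [^] n = ordered_prod S (\<lambda>i. factor (int i - int (Suc n))) (Suc n)"
    using Suc by (subst ordered_prod_Suc_left) (auto simp: m_assoc)
  finally show ?case .
qed simp

end

section \<open>Exchanging a generator with a subalgebra\<close>

context star_alg
begin

text \<open>\<open>H\<close> absorbs the change that \<open>d\<close> undergoes when it passes \<open>x\<close>. Both directions are required so
  that the property is inherited by \<open>d\<^sup>*\<close>.\<close>

definition exchanges :: "'a set \<Rightarrow> 'a \<Rightarrow> 'a \<Rightarrow> bool" where
  "exchanges H x d \<longleftrightarrow> (\<exists>d'\<in>H. d \<otimes> x = x \<otimes> d') \<and> (\<exists>d'\<in>H. x \<otimes> d = d' \<otimes> x)"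

lemma exchangesI: "\<lbrakk>d \<otimes> x = x \<otimes> d1; x \<otimes> d = d2 \<otimes> x; d1 \<in> H; d2 \<in> H\<rbrakk> \<Longrightarrow> exchanges H x d"
  by (auto simp: exchanges_def)

lemma exchangesE:
  assumes "exchanges H x d"
  obtains d1 d2 where "d1 \<in> H" "d2 \<in> H" "d \<otimes> x = x \<otimes> d1" "x \<otimes> d = d2 \<otimes> x"
  using assms by (auto simp: exchanges_def)

lemma skew_commute_exchanges:
  assumes H: "star_subalgebra H S" and "skew_commute d x c" "c \<noteq> 0" "d \<in> H" "x \<in> carrier S"
  shows "exchanges H x d"
proof (rule exchangesI)
  have d: "d \<in> carrier S" using assms star_subalgebraD(1)[OF H] by auto
  show "d \<otimes> x = x \<otimes> (c \<odot> d)" using assms d by (simp add: skew_commute_def smult_mult_r)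
  show "x \<otimes> d = (inverse c \<odot> d) \<otimes> x"
    using assms d by (simp add: skew_commute_def smult_mult_l smult_smult)
qed (use assms star_subalgebraD(5)[OF H] in auto)

text \<open>It therefore suffices to check generators of \<open>H\<close>.\<close>

lemma exchanges_star_subalgebra:
  assumes H: "star_subalgebra H S" and L: "L \<subseteq> carrier S" "\<And>x. x \<in> L \<Longrightarrow> star S x \<in> L"
  shows "star_subalgebra {d \<in> H. \<forall>x\<in>L. exchanges H x d} S"
proof -
  note H_closed = star_subalgebraD[OF H]
  have Hc: "d \<in> carrier S" if "d \<in> H" for d using that H_closed(1) by auto
  have Lc: "x \<in> carrier S" if "x \<in> L" for x using that L(1) by auto
  have one: "exchanges H x \<one>" if "x \<in> L" for x
    using Lc[OF that] H_closed(2) by (intro exchangesI[of \<one> x \<one> \<one>]) auto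
  have add_mult: "exchanges H x (c \<oplus> d)" "exchanges H x (c \<otimes> d)"
    if x: "x \<in> L" and cd: "c \<in> H" "d \<in> H" and c: "exchanges H x c" and d: "exchanges H x d" for x c d
  proof -
    obtain c1 c2 where c12: "c1 \<in> H" "c2 \<in> H" "c \<otimes> x = x \<otimes> c1" "x \<otimes> c = c2 \<otimes> x"
      using c by (rule exchangesE)
    obtain d1 d2 where d12: "d1 \<in> H" "d2 \<in> H" "d \<otimes> x = x \<otimes> d1" "x \<otimes> d = d2 \<otimes> x"
      using d by (rule exchangesE)
    note cl = Lc[OF x] cd[THEN Hc] c12(1,2)[THEN Hc] d12(1,2)[THEN Hc]
    show "exchanges H x (c \<oplus> d)"
      using cl by (intro exchangesI[of _ _ "c1 \<oplus> d1" "c2 \<oplus> d2"] H_closed(3) c12(1,2) d12(1,2))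
        (simp_all add: l_distr r_distr c12 d12)
    have "c \<otimes> d \<otimes> x = (c \<otimes> x) \<otimes> d1" using cl by (simp add: m_assoc d12)
    then have 1: "c \<otimes> d \<otimes> x = x \<otimes> (c1 \<otimes> d1)" using cl by (simp add: m_assoc c12)
    have "x \<otimes> (c \<otimes> d) = c2 \<otimes> (x \<otimes> d)" using cl by (simp add: m_assoc[symmetric] c12)
    then have 2: "x \<otimes> (c \<otimes> d) = (c2 \<otimes> d2) \<otimes> x" using cl by (simp add: m_assoc d12)
    show "exchanges H x (c \<otimes> d)"
      by (rule exchangesI[OF 1 2]) (intro H_closed(4) c12(1,2) d12(1,2))+
  qed
  have smult_star: "exchanges H x (c \<odot> d)" "exchanges H x (star S d)"
    if x: "x \<in> L" and d: "d \<in> H" "exchanges H x d" "exchanges H (star S x) d" for x c d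
  proof -
    obtain d1 d2 where d12: "d1 \<in> H" "d2 \<in> H" "d \<otimes> x = x \<otimes> d1" "x \<otimes> d = d2 \<otimes> x"
      using d(2) by (rule exchangesE)
    obtain d3 d4 where d34: "d3 \<in> H" "d4 \<in> H" "d \<otimes> star S x = star S x \<otimes> d3" "star S x \<otimes> d = d4 \<otimes> star S x"
      using d(3) by (rule exchangesE)
    note cl = Lc[OF x] d(1)[THEN Hc] d12(1,2)[THEN Hc] d34(1,2)[THEN Hc]
    show "exchanges H x (c \<odot> d)"
      using cl by (intro exchangesI[of _ _ "c \<odot> d1" "c \<odot> d2"] H_closed(5) d12(1,2))
        (simp_all add: smult_mult_l smult_mult_r d12)
    show "exchanges H x (star S d)"
      using arg_cong[OF d34(3), of "star S"] arg_cong[OF d34(4), of "star S"] cl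
      by (intro exchangesI[of _ _ "star S d4" "star S d3"] H_closed(6) d34(1,2)) (simp_all add: star_mult)
  qed
  show ?thesis
    by (rule star_subalgebraI) (simp_all add: Hc subset_iff one add_mult smult_star L(2) H_closed)
qed

end

definition degree_in :: "'g \<Rightarrow> ('g \<times> bool) list \<Rightarrow> int" where
  "degree_in g w = (\<Sum>(h, adj)\<leftarrow>w. if h = g then (if adj then -1 else 1) else 0)"

lemma degree_in_simps [simp]:
  "degree_in g [] = 0"
  "degree_in g (v @ w) = degree_in g v + degree_in g w"
  "degree_in g ((h, adj) # w) = (if h = g then (if adj then -1 else 1) else 0) + degree_in g w"
  by (auto simp: degree_in_def)

section \<open>Heegaard pairs\<close>

text \<open>Elements of an arbitrary star-algebra that satisfy the defining relations of the Heegaard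
  quantum 3-sphere. Instances are the generators themselves and their images under the coaction.\<close>

locale heegaard_pair = star_alg S + A: quantum_disc S a p + B: quantum_disc S b q
  for S :: "('a, 'y) star_algebra_scheme" (structure) and a p b q +
  fixes \<theta> :: real
  assumes ab_relation: "(a \<otimes> b) \<ominus> (exp (2 * of_real pi * \<i> * of_real \<theta>) \<odot> (b \<otimes> a)) = \<zero>"
    and ab_star_relation: "(a \<otimes> star S b) \<ominus> (exp (- 2 * of_real pi * \<i> * of_real \<theta>) \<odot> (star S b \<otimes> a)) = \<zero>"
    and AB_relation: "(\<one> \<ominus> (a \<otimes> star S a)) \<otimes> (\<one> \<ominus> (b \<otimes> star S b)) = \<zero>"
begin

lemma AB: "A.Z \<otimes> B.Z = \<zero>" using AB_relation by (simp add: A.Z_def B.Z_def)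

lemma BA: "B.Z \<otimes> A.Z = \<zero>"
  using arg_cong[OF AB, of "star S"] by (simp add: star_mult)

definition phase where "phase = exp (2 * of_real pi * \<i> * of_real \<theta>)"

lemma phase_nonzero [simp]: "phase \<noteq> 0" by (simp add: phase_def)

lemma exp_minus_eq: "exp (- 2 * of_real pi * \<i> * of_real \<theta>) = inverse phase"
  by (simp add: phase_def exp_minus[symmetric])

lemma cnj_phase [simp]: "cnj phase = inverse phase"
proof -
  have "phase = cis (2 * pi * \<theta>)" by (simp add: phase_def cis_conv_exp mult_ac)
  then show ?thesis by (simp add: cis_cnj cis_inverse)
qed

text \<open>Two of these are the given relations; the others follow by adjoints and by inverting the phase,
  whose conjugate is its inverse.\<close>

lemma letters_skew:
  shows "skew_commute a b phase" "skew_commute a (star S b) (inverse phase)"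
    "skew_commute (star S a) b (inverse phase)" "skew_commute (star S a) (star S b) phase"
    "skew_commute b a (inverse phase)" "skew_commute (star S b) a phase"
    "skew_commute b (star S a) phase" "skew_commute (star S b) (star S a) (inverse phase)"
proof -
  show 1: "skew_commute a b phase" using ab_relation by (simp add: skew_commute_def phase_def minus_eq_zero_iff)
  show 2: "skew_commute a (star S b) (inverse phase)"
    using ab_star_relation unfolding exp_minus_eq by (simp add: skew_commute_def minus_eq_zero_iff)
  show 3: "skew_commute b (star S a) phase" using skew_commute_star[OF _ _ 2] by simp
  show 4: "skew_commute (star S b) (star S a) (inverse phase)" using skew_commute_star[OF _ _ 1] by simp
  show "skew_commute b a (inverse phase)" using skew_commute_sym[OF _ _ 1] by simp
  show "skew_commute (star S b) a phase" using skew_commute_sym[OF _ _ 2] by simp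
  show "skew_commute (star S a) b (inverse phase)" using skew_commute_sym[OF _ _ 3] by simp
  show "skew_commute (star S a) (star S b) phase" using skew_commute_sym[OF _ _ 4] by simp
qed

text \<open>The phases of \<open>a\<close> and \<open>a\<^sup>*\<close> are inverse to each other, so they cancel in \<open>aa\<^sup>*\<close>.\<close>

lemma A_skew: "skew_commute A.Z b 1" "skew_commute A.Z (star S b) 1"
  unfolding A.Z_def
  using skew_commute_mult_left[OF _ _ _ letters_skew(1) letters_skew(3)]
    skew_commute_mult_left[OF _ _ _ letters_skew(2) letters_skew(4)]
  by (auto intro!: skew_commute_minus skew_commute_one)

lemma B_skew: "skew_commute B.Z a 1" "skew_commute B.Z (star S a) 1"
  unfolding B.Z_def
  using skew_commute_mult_left[OF _ _ _ letters_skew(5) letters_skew(6)]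
    skew_commute_mult_left[OF _ _ _ letters_skew(7) letters_skew(8)]
  by (auto intro!: skew_commute_minus skew_commute_one)

abbreviation X where "X n \<equiv> star_power a n"
abbreviation Y where "Y n \<equiv> star_power b n"

lemma A_skew_Y: "skew_commute A.Z (Y n) 1"
  using skew_commute_pow_right[OF _ _ A_skew(1), of "nat n"] skew_commute_pow_right[OF _ _ A_skew(2), of "nat \<bar>n\<bar>"]
  by (auto simp: star_power_def)

lemma B_skew_X: "skew_commute B.Z (X n) 1"
  using skew_commute_pow_right[OF _ _ B_skew(1), of "nat n"] skew_commute_pow_right[OF _ _ B_skew(2), of "nat \<bar>n\<bar>"]
  by (auto simp: star_power_def)

lemma X_skew_Y: "\<exists>c. skew_commute (X m) (Y n) c" and Y_skew_X: "\<exists>c. skew_commute (Y n) (X m) c"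
proof -
  obtain c where c: "skew_commute a (Y n) c"
    using skew_commute_star_power[OF _ _ letters_skew(1,2)] by blast
  obtain d where d: "skew_commute (star S a) (Y n) d"
    using skew_commute_star_power[OF _ _ letters_skew(3,4)] by blast
  show "\<exists>c. skew_commute (X m) (Y n) c"
    using skew_commute_pow_left[OF _ _ c, of "nat m"] skew_commute_pow_left[OF _ _ d, of "nat \<bar>m\<bar>"]
    by (auto simp: star_power_def)
  obtain c where c: "skew_commute b (X m) c"
    using skew_commute_star_power[OF _ _ letters_skew(5,7)] by blast
  obtain d where d: "skew_commute (star S b) (X m) d"
    using skew_commute_star_power[OF _ _ letters_skew(6,8)] by blast
  show "\<exists>c. skew_commute (Y n) (X m) c"
    using skew_commute_pow_left[OF _ _ c, of "nat n"] skew_commute_pow_left[OF _ _ d, of "nat \<bar>n\<bar>"]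
    by (auto simp: star_power_def)
qed

section \<open>The relations between \<open>A\<close>, \<open>B\<close> and \<open>C\<close>\<close>

text \<open>One formula for both signs of \<open>l\<close>: the element \<open>a\<^sup>l b\<^sup>*\<^sup>k\<close> for \<open>l > 0\<close>, and for \<open>l < 0\<close> the same
  with \<open>a\<^sup>l\<close> read as the power \<open>-l\<close> of \<open>a\<^sup>*\<close>.\<close>

definition C where "C k l = X l \<otimes> Y (- k)"

lemma C_closed [simp]: "C k l \<in> carrier S" by (simp add: C_def)

lemma AC: "A.Z \<otimes> C k l = of_real (p powi l) \<odot> (C k l \<otimes> A.Z)"
  using skew_commute_mult_right[OF _ _ _ A.Z_star_power A_skew_Y] by (simp add: skew_commute_def C_def)

lemma BC: "B.Z \<otimes> C k l = of_real (q powi (- k)) \<odot> (C k l \<otimes> B.Z)"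
  using skew_commute_mult_right[OF _ _ _ B_skew_X B.Z_star_power] by (simp add: skew_commute_def C_def)

lemma star_X_mult_X:
  "l \<ge> 0 \<Longrightarrow> star S (X l) \<otimes> X l = ordered_prod S (\<lambda>i. A.factor (int i)) (nat l)"
  "l < 0 \<Longrightarrow> star S (X l) \<otimes> X l = ordered_prod S (\<lambda>i. A.factor (int i + l)) (nat \<bar>l\<bar>)"
  "l \<ge> 0 \<Longrightarrow> X l \<otimes> star S (X l) = ordered_prod S (\<lambda>i. A.factor (int i - l)) (nat l)"
  "l < 0 \<Longrightarrow> X l \<otimes> star S (X l) = ordered_prod S (\<lambda>i. A.factor (int i)) (nat \<bar>l\<bar>)"
  using A.star_pow_mult_pow[of "nat l"] A.pow_mult_star_pow[of "nat l"]
    A.star_pow_mult_pow[of "nat \<bar>l\<bar>"] A.pow_mult_star_pow[of "nat \<bar>l\<bar>"]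
  by (simp_all add: star_power_def star_pow)

lemma star_Y_mult_Y:
  assumes "k > 0"
  shows "star S (Y (- k)) \<otimes> Y (- k) = ordered_prod S (\<lambda>j. B.factor (int j - k)) (nat k)"
    "Y (- k) \<otimes> star S (Y (- k)) = ordered_prod S (\<lambda>j. B.factor (int j)) (nat k)"
  using assms B.star_pow_mult_pow[of "nat k"] B.pow_mult_star_pow[of "nat k"]
  by (simp_all add: star_power_def star_pow)

lemma A_products_skew_Y: "skew_commute (ordered_prod S (\<lambda>i. A.factor (g i)) n) (Y m) 1"
  using A_skew_Y by (intro ordered_prod_skew) (auto simp: A.factor_def skew_commute_def minus_mult_l minus_mult_r smult_mult_l smult_mult_r)

lemma B_products_skew_X: "skew_commute (ordered_prod S (\<lambda>i. B.factor (g i)) n) (X m) 1"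
  using B_skew_X by (intro ordered_prod_skew) (auto simp: B.factor_def skew_commute_def minus_mult_l minus_mult_r smult_mult_l smult_mult_r)

text \<open>Each factor \<open>1 - cA\<close> fixes \<open>B\<close>, since \<open>AB = 0\<close>.\<close>

lemma product_AB:
  "ordered_prod S (\<lambda>i. A.factor (g i)) m \<otimes> ordered_prod S (\<lambda>j. B.factor (h j)) n =
    ordered_prod S (\<lambda>i. A.factor (g i)) m \<oplus> ordered_prod S (\<lambda>j. B.factor (h j)) n \<ominus> \<one>"
proof (rule prod_eq_sum_minus_one)
  show "ordered_prod S (\<lambda>i. A.factor (g i)) m \<otimes> B.Z = B.Z"
    by (rule ordered_prod_absorb) (auto simp: A.factor_def minus_mult_l smult_mult_l AB, simp add: minus_eq)
qed (auto simp: B.factor_def)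

text \<open>The product of the powers of \<open>a\<close> and \<open>a\<^sup>*\<close> in the middle is a polynomial in \<open>A\<close>, which commutes
  with \<open>b\<close>.\<close>

lemma star_C_mult_C:
  assumes XX: "star S (X l) \<otimes> X l = ordered_prod S (\<lambda>i. A.factor (g i)) m" and k: "k > 0"
  shows "star S (C k l) \<otimes> C k l = ordered_prod S (\<lambda>i. A.factor (g i)) m \<otimes> ordered_prod S (\<lambda>j. B.factor (int j - k)) (nat k)"
proof -
  let ?P = "ordered_prod S (\<lambda>i. A.factor (g i)) m" and ?y = "Y (- k)"
  have "star S (C k l) \<otimes> C k l = star S ?y \<otimes> ((star S (X l) \<otimes> X l) \<otimes> ?y)"
    by (simp add: C_def star_mult m_assoc)
  also have "\<dots> = (star S ?y \<otimes> ?P) \<otimes> ?y" by (simp add: XX m_assoc)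
  also have "star S ?y \<otimes> ?P = ?P \<otimes> star S ?y"
    using A_products_skew_Y[of g m k] by (simp add: skew_commute_def star_star_power)
  also have "?P \<otimes> star S ?y \<otimes> ?y = ?P \<otimes> (star S ?y \<otimes> ?y)" by (simp add: m_assoc)
  finally show ?thesis using star_Y_mult_Y(1)[OF k] by simp
qed

text \<open>The product of the powers of \<open>b\<close> and \<open>b\<^sup>*\<close> in the middle is a polynomial in \<open>B\<close>, which commutes
  with \<open>a\<close>.\<close>

lemma C_mult_star_C:
  assumes XX: "X l \<otimes> star S (X l) = ordered_prod S (\<lambda>i. A.factor (g i)) m" and k: "k > 0"
  shows "C k l \<otimes> star S (C k l) = ordered_prod S (\<lambda>i. A.factor (g i)) m \<otimes> ordered_prod S (\<lambda>j. B.factor (int j)) (nat k)"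
proof -
  let ?Q = "ordered_prod S (\<lambda>j. B.factor (int j)) (nat k)" and ?y = "Y (- k)"
  have "C k l \<otimes> star S (C k l) = X l \<otimes> ((?y \<otimes> star S ?y) \<otimes> star S (X l))"
    by (simp add: C_def star_mult m_assoc)
  also have "\<dots> = X l \<otimes> (?Q \<otimes> X (- l))" by (simp only: star_Y_mult_Y(2)[OF k]) (simp add: star_star_power)
  also have "?Q \<otimes> X (- l) = X (- l) \<otimes> ?Q"
    using B_products_skew_X by (simp add: skew_commute_def)
  also have "X l \<otimes> (X (- l) \<otimes> ?Q) = (X l \<otimes> star S (X l)) \<otimes> ?Q"
    by (simp add: star_star_power m_assoc)
  finally show ?thesis by (simp add: XX)
qed

section \<open>Normal form of words\<close>

definition D where "D = generated_star_subalgebra S {A.Z, B.Z}"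

lemma D: "star_subalgebra D S" unfolding D_def by (rule generated_star_subalgebra_is_star_subalgebra) auto

lemmas D_closed = star_subalgebraD[OF D]

lemma AB_in_D: "A.Z \<in> D" "B.Z \<in> D"
  using generated_star_subalgebra_incl[of "{A.Z, B.Z}" S] by (auto simp: D_def)

lemma D_carrier [simp]: "d \<in> D \<Longrightarrow> d \<in> carrier S" using D_closed(1) by auto

lemma D_letters:
  assumes "d \<in> D" "x \<in> {a, star S a, b, star S b}"
  shows "\<exists>d'\<in>D. d \<otimes> x = x \<otimes> d'"
proof -
  let ?L = "{a, star S a, b, star S b}"
  have "star_subalgebra {d \<in> D. \<forall>x\<in>?L. exchanges D x d} S"
    by (rule exchanges_star_subalgebra[OF D]) auto
  moreover have "{A.Z, B.Z} \<subseteq> {d \<in> D. \<forall>x\<in>?L. exchanges D x d}"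
    using skew_commute_exchanges[OF D A.Z_z] skew_commute_exchanges[OF D A.Z_star_z]
      skew_commute_exchanges[OF D A_skew(1)] skew_commute_exchanges[OF D A_skew(2)]
      skew_commute_exchanges[OF D B.Z_z] skew_commute_exchanges[OF D B.Z_star_z]
      skew_commute_exchanges[OF D B_skew(1)] skew_commute_exchanges[OF D B_skew(2)] AB_in_D A.r_pos B.r_pos
    by simp
  ultimately have "generated_star_subalgebra S {A.Z, B.Z} \<subseteq> {d \<in> D. \<forall>x\<in>?L. exchanges D x d}"
    by (rule generated_star_subalgebra_minimal)
  then have "exchanges D x d" using assms by (auto simp flip: D_def)
  then show ?thesis by (auto simp: exchanges_def)
qed

lemma D_pow:
  assumes "x \<in> {a, star S a, b, star S b}" "d \<in> D"
  shows "\<exists>d'\<in>D. d \<otimes> x [^] (n::nat) = x [^] n \<otimes> d'"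
proof (induction n)
  case 0 show ?case using assms by (intro bexI[of _ d]) auto
next
  case (Suc n)
  have x: "x \<in> carrier S" using assms by auto
  obtain d' where d': "d' \<in> D" "d \<otimes> x [^] n = x [^] n \<otimes> d'" using Suc by blast
  obtain d'' where d'': "d'' \<in> D" "d' \<otimes> x = x \<otimes> d''" using D_letters[OF d'(1) assms(1)] by blast
  have "d \<otimes> x [^] Suc n = (d \<otimes> x [^] n) \<otimes> x" using assms x by (simp add: m_assoc)
  also have "\<dots> = x [^] n \<otimes> (d' \<otimes> x)" using d' x by (simp add: m_assoc)
  also have "\<dots> = x [^] Suc n \<otimes> d''" using d'' x by (simp add: m_assoc)
  finally show ?case using d''(1) by blast
qed

lemma D_Y: "d \<in> D \<Longrightarrow> \<exists>d'\<in>D. d \<otimes> Y n = Y n \<otimes> d'"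
  using D_pow[of b d] D_pow[of "star S b" d] by (simp add: star_power_def)

abbreviation letter where "letter g \<equiv> (case g of GenA \<Rightarrow> a | GenB \<Rightarrow> b)"

lemma letter_closed: "letter g \<in> carrier S" by (cases g) auto

lemma one_minus_in_D: "\<one> \<ominus> c \<odot> A.Z \<in> D" "\<one> \<ominus> c \<odot> B.Z \<in> D"
  using star_subalgebra_minus[OF D] D_closed(2,5) AB_in_D by auto

text \<open>When a letter is appended, it moves to the left past \<open>d\<close> and, if it is \<open>a\<close> or \<open>a\<^sup>*\<close>, past the power
  of \<open>b\<close>. It then joins the power of its own kind, which may leave a factor \<open>1 - cA\<close> or \<open>1 - cB\<close>;
  that factor moves back to the right.\<close>

lemma word_normal_form:
  "\<exists>d\<in>D. word_value S letter w = X (degree_in GenA w) \<otimes> Y (degree_in GenB w) \<otimes> d"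
proof (induction w rule: rev_induct)
  case Nil
  show ?case using D_closed(2) by (intro bexI[of _ \<one>]) (auto simp: word_value_def)
next
  case (snoc x w)
  let ?m = "degree_in GenA w" and ?n = "degree_in GenB w"
  obtain d where d: "d \<in> D" "word_value S letter w = X ?m \<otimes> Y ?n \<otimes> d" using snoc by blast
  obtain g adj where x: "x = (g, adj)" by force
  let ?x = "if adj then star S (letter g) else letter g"
  have xL: "?x \<in> {a, star S a, b, star S b}" by (cases g) auto
  then have xc: "?x \<in> carrier S" by auto
  obtain d' where d': "d' \<in> D" "d \<otimes> ?x = ?x \<otimes> d'" using D_letters[OF d(1) xL] by blast
  have "word_value S letter (w @ [x]) = word_value S letter w \<otimes> ?x"
    using xc by (subst word_value_append) (simp_all add: letter_closed x word_value_def)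
  also have "\<dots> = X ?m \<otimes> (Y ?n \<otimes> (d \<otimes> ?x))" using d xc by (simp add: m_assoc)
  also have "\<dots> = X ?m \<otimes> (Y ?n \<otimes> ?x) \<otimes> d'" unfolding d'(2) using d'(1) xc by (simp add: m_assoc)
  finally have eq: "word_value S letter (w @ [x]) = X ?m \<otimes> (Y ?n \<otimes> ?x) \<otimes> d'" .
  \<comment> \<open>the change of the exponent caused by the letter\<close>
  define s :: int where "s = (if adj then -1 else 1)"
  show ?case
  proof (cases g)
    case GenA
    obtain c where c: "skew_commute (Y ?n) (X s) c" using Y_skew_X by blast
    have Xs: "X s = ?x" by (simp add: s_def GenA star_power_def)
    have "\<exists>c'. X ?m \<otimes> ?x = X (?m + s) \<otimes> (\<one> \<ominus> c' \<odot> A.Z)"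
      using A.star_power_mult_z[of ?m] A.star_power_mult_star_z[of ?m] by (cases adj) (simp_all add: GenA s_def)
    then obtain c' where c': "X ?m \<otimes> X s = X (?m + s) \<otimes> (\<one> \<ominus> c' \<odot> A.Z)"
      unfolding Xs by blast
    obtain d'' where d'': "d'' \<in> D" "(\<one> \<ominus> c' \<odot> A.Z) \<otimes> Y ?n = Y ?n \<otimes> d''"
      using D_Y[OF one_minus_in_D(1)] by blast
    have "word_value S letter (w @ [x]) = c \<odot> ((X ?m \<otimes> X s) \<otimes> Y ?n \<otimes> d')"
      using c d'(1) unfolding eq Xs[symmetric]
      by (simp add: skew_commute_def smult_mult_l smult_mult_r m_assoc)
    also have "\<dots> = c \<odot> (X (?m + s) \<otimes> ((\<one> \<ominus> c' \<odot> A.Z) \<otimes> Y ?n) \<otimes> d')"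
      using d'(1) by (simp add: c' m_assoc)
    also have "\<dots> = X (?m + s) \<otimes> Y ?n \<otimes> (c \<odot> (d'' \<otimes> d'))"
      using d'(1) d''(1) unfolding d''(2) by (simp add: m_assoc smult_mult_r)
    finally show ?thesis
      using D_closed(4,5) d'(1) d''(1) by (intro bexI[of _ "c \<odot> (d'' \<otimes> d')"]) (auto simp: x GenA s_def)
  next
    case GenB
    have "\<exists>c'. Y ?n \<otimes> ?x = Y (?n + s) \<otimes> (\<one> \<ominus> c' \<odot> B.Z)"
      using B.star_power_mult_z[of ?n] B.star_power_mult_star_z[of ?n] by (cases adj) (simp_all add: GenB s_def)
    then obtain c' where c': "Y ?n \<otimes> ?x = Y (?n + s) \<otimes> (\<one> \<ominus> c' \<odot> B.Z)" by blast
    have "word_value S letter (w @ [x]) = X ?m \<otimes> Y (?n + s) \<otimes> ((\<one> \<ominus> c' \<odot> B.Z) \<otimes> d')"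
      using d'(1) unfolding eq c' by (simp add: m_assoc)
    then show ?thesis
      using D_closed(4) d'(1) one_minus_in_D by (intro bexI[of _ "(\<one> \<ominus> c' \<odot> B.Z) \<otimes> d'"]) (auto simp: x GenB s_def)
  qed
qed

text \<open>For \<open>t \<ge> 0\<close> both exponents keep their sign while \<open>t\<close> grows, so no cancellation occurs and each step
  contributes one more factor \<open>C\<close>; for \<open>t < 0\<close> the adjoint is taken.\<close>

lemma XY_in_generated:
  assumes k: "k > 0"
  shows "X (l * t) \<otimes> Y (- (k * t)) \<in> generated_star_subalgebra S {A.Z, B.Z, C k l}"
proof -
  let ?G = "generated_star_subalgebra S {A.Z, B.Z, C k l}"
  have G: "star_subalgebra ?G S" by (rule generated_star_subalgebra_is_star_subalgebra) auto
  have C: "C k l \<in> ?G" using generated_star_subalgebra_incl[of "{A.Z, B.Z, C k l}" S] by auto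
  note G_closed = star_subalgebraD[OF G]
  \<comment> \<open>moving the power of \<open>b\<close> past \<open>X l\<close> costs a scalar, which is harmless in a subalgebra\<close>
  have nonneg: "X (l * int n) \<otimes> Y (- (k * int n)) \<in> ?G" for n
  proof (induction n)
    case 0 show ?case using G_closed(2) by simp
  next
    case (Suc n)
    let ?x = "X (l * int n)" and ?y = "Y (- (k * int n))"
    obtain c where c: "skew_commute (X l) ?y c" using X_skew_Y by blast
    have 1: "X (l * int (Suc n)) = ?x \<otimes> X l"
      using star_power_add_nonneg[of a "l * int n" l] star_power_add_nonpos[of a "l * int n" l]
      by (cases "l \<ge> 0") (auto simp: distrib_left add.commute mult_nonpos_nonneg)
    have 2: "Y (- (k * int (Suc n))) = ?y \<otimes> Y (- k)"
      using star_power_add_nonpos[of b "- (k * int n)" "- k"] k by (simp add: distrib_left add.commute)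
    have "X (l * int (Suc n)) \<otimes> Y (- (k * int (Suc n))) = ?x \<otimes> (X l \<otimes> ?y) \<otimes> Y (- k)"
      unfolding 1 2 by (simp add: m_assoc)
    also have "\<dots> = c \<odot> ((?x \<otimes> ?y) \<otimes> C k l)"
      using c by (simp add: skew_commute_def C_def smult_mult_l smult_mult_r m_assoc)
    finally show ?case using Suc C G_closed(4,5) by simp
  qed
  show ?thesis
  proof (cases "t \<ge> 0")
    case True
    then show ?thesis using nonneg[of "nat t"] by simp
  next
    case False
    define n where "n = nat (- t)"
    have t: "t = - int n" using False by (simp add: n_def)
    obtain c where c: "skew_commute (X (- (l * int n))) (Y (k * int n)) c" using X_skew_Y by blast
    have "X (l * t) \<otimes> Y (- (k * t)) = c \<odot> star S (X (l * int n) \<otimes> Y (- (k * int n)))"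
      using c by (simp add: t skew_commute_def star_mult star_star_power)
    then show ?thesis using nonneg[of n] G_closed(5,6) by simp
  qed
qed

text \<open>Coprimality makes the pair of letter counts an integer multiple of \<open>(l, -k)\<close>.\<close>

lemma degree_zero_word_in_generated:
  assumes k: "k > 0" and kl: "coprime k l" and deg: "k * degree_in GenA w + l * degree_in GenB w = 0"
  shows "word_value S letter w \<in> generated_star_subalgebra S {A.Z, B.Z, C k l}"
proof -
  let ?G = "generated_star_subalgebra S {A.Z, B.Z, C k l}"
  have G: "star_subalgebra ?G S" by (rule generated_star_subalgebra_is_star_subalgebra) auto
  have "{A.Z, B.Z} \<subseteq> ?G" using generated_star_subalgebra_incl[of "{A.Z, B.Z, C k l}" S] by auto
  then have DG: "D \<subseteq> ?G" unfolding D_def by (rule generated_star_subalgebra_minimal[OF G])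
  have eq: "l * degree_in GenB w = k * (- degree_in GenA w)" using deg by simp
  then have "k dvd degree_in GenB w"
    using kl by (metis coprime_dvd_mult_right_iff dvd_triv_left)
  then obtain t where t: "degree_in GenB w = k * t" by blast
  then have "k * (degree_in GenA w + l * t) = 0" using eq by (simp add: algebra_simps)
  then have "degree_in GenA w = l * (- t)" using k by simp
  then have "X (degree_in GenA w) \<otimes> Y (degree_in GenB w) \<in> ?G"
    using XY_in_generated[OF k, of l "- t"] t by simp
  then show ?thesis using word_normal_form[of w] DG star_subalgebraD(4)[OF G] by auto
qed

end

section \<open>The presentations of the two coordinate algebras\<close>

text \<open>This is used twice: for the projection onto the quotient it gives the relations in the algebra
  itself, and for homomorphisms into other star-algebras the hypothesis of the universal property.\<close>

lemma S3_relations_hom: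
  assumes "star_hom free_star_algebra T h" "p > 0" "q > 0"
  shows "(\<forall>r\<in>S3_relations p q \<theta>. h r = \<zero>\<^bsub>T\<^esub>) \<longleftrightarrow>
    heegaard_pair T (h (free_gen GenA)) p (h (free_gen GenB)) q \<theta>"
proof -
  interpret h: star_hom free_star_algebra T h by fact
  show ?thesis
    unfolding S3_relations_def Let_def heegaard_pair_def heegaard_pair_axioms_def quantum_disc_def
      quantum_disc_axioms_def
    by (simp add: h.homs assms h.T.star_alg_axioms) blast
qed

context
  fixes p q \<theta> :: real
  assumes p: "p > 0" and q: "q > 0"
begin

lemma OS3_star_alg: "star_alg (OS3 p q \<theta>)"
  unfolding OS3_def by (rule presented_star_alg)

lemma OS3_heegaard_pair: "heegaard_pair (OS3 p q \<theta>) (gen_a p q \<theta>) p (gen_b p q \<theta>) q \<theta>"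
proof -
  let ?R = "S3_relations p q \<theta>"
  let ?h = "(+>\<^bsub>free_star_algebra\<^esub>) (relation_ideal ?R)"
  have hom: "star_hom free_star_algebra (OS3 p q \<theta>) ?h"
    using presented_coset_hom[of ?R] by (intro star_homI word.CM.star_alg_axioms OS3_star_alg) (simp add: OS3_def)
  have "?h r = \<zero>\<^bsub>OS3 p q \<theta>\<^esub>" if "r \<in> ?R" for r
    using that relations_subset_ideal presented_coset_eq_zero_iff[of r ?R] by (auto simp: OS3_def)
  then have "heegaard_pair (OS3 p q \<theta>) (?h (free_gen GenA)) p (?h (free_gen GenB)) q \<theta>"
    using S3_relations_hom[OF hom p q, of \<theta>] by blast
  then show ?thesis by (simp only: gen_a_def gen_b_def presented_gen_def)
qed

lemma OS3_lift:
  assumes "heegaard_pair T x p y q \<theta>"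
  obtains g where "g \<in> star_alg_hom (OS3 p q \<theta>) T" "g (gen_a p q \<theta>) = x" "g (gen_b p q \<theta>) = y"
proof -
  interpret T: heegaard_pair T x p y q \<theta> by fact
  let ?h = "linear_extension T (word_value T T.letter)"
  have h: "?h \<in> star_alg_hom free_star_algebra T" "?h (free_gen GenA) = x" "?h (free_gen GenB) = y"
    using T.free_lift[of T.letter, OF T.letter_closed] by auto
  then have "star_hom free_star_algebra T ?h"
    by (intro star_homI word.CM.star_alg_axioms T.star_alg_axioms)
  then have "?h r = \<zero>\<^bsub>T\<^esub>" if "r \<in> S3_relations p q \<theta>" for r
    using S3_relations_hom[OF _ p q] that assms h by metis
  then show thesis
    using presented_lift[OF T.star_alg_axioms h(1), of "S3_relations p q \<theta>"] that h
    unfolding OS3_def gen_a_def gen_b_def presented_gen_def by metis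
qed

end

lemma U1_relations_hom:
  assumes "star_hom free_star_algebra T h"
  shows "(\<forall>r\<in>U1_relations. h r = \<zero>\<^bsub>T\<^esub>) \<longleftrightarrow>
    h (free_gen ()) \<otimes>\<^bsub>T\<^esub> star T (h (free_gen ())) = \<one>\<^bsub>T\<^esub> \<and>
    star T (h (free_gen ())) \<otimes>\<^bsub>T\<^esub> h (free_gen ()) = \<one>\<^bsub>T\<^esub>"
proof -
  interpret h: star_hom free_star_algebra T h by fact
  show ?thesis
    unfolding U1_relations_def Let_def by (simp add: h.homs h.T.minus_eq_zero_iff)
qed

lemma OU1_star_alg: "star_alg OU1"
  unfolding OU1_def by (rule presented_star_alg)

interpretation OU1: star_alg OU1 by (rule OU1_star_alg)

lemma gen_u_closed [simp]: "gen_u \<in> carrier OU1"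
  by (simp add: OU1_def gen_u_def)

lemma gen_u_unitary:
  "gen_u \<otimes>\<^bsub>OU1\<^esub> star OU1 gen_u = \<one>\<^bsub>OU1\<^esub>" "star OU1 gen_u \<otimes>\<^bsub>OU1\<^esub> gen_u = \<one>\<^bsub>OU1\<^esub>"
proof -
  let ?h = "(+>\<^bsub>free_star_algebra\<^esub>) (relation_ideal U1_relations)"
  have hom: "star_hom free_star_algebra OU1 ?h"
    using presented_coset_hom[of U1_relations]
    by (intro star_homI word.CM.star_alg_axioms OU1_star_alg) (simp add: OU1_def)
  have "?h r = \<zero>\<^bsub>OU1\<^esub>" if "r \<in> U1_relations" for r
    using that relations_subset_ideal presented_coset_eq_zero_iff[of r U1_relations] by (auto simp: OU1_def)
  then show "gen_u \<otimes>\<^bsub>OU1\<^esub> star OU1 gen_u = \<one>\<^bsub>OU1\<^esub>" "star OU1 gen_u \<otimes>\<^bsub>OU1\<^esub> gen_u = \<one>\<^bsub>OU1\<^esub>"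
    using U1_relations_hom[OF hom] unfolding gen_u_def presented_gen_def by blast+
qed

lemma u_power_eq: "u_power n = OU1.star_power gen_u n"
  by (simp add: u_power_def OU1.star_power_def)

lemma u_power_closed [simp]: "u_power n \<in> carrier OU1"
  by (simp add: u_power_eq OU1.star_power_closed)

lemma u_power_add: "u_power (m + n) = u_power m \<otimes>\<^bsub>OU1\<^esub> u_power n"
  by (simp add: u_power_eq OU1.unitary_star_power_add gen_u_unitary)

lemma u_power_0: "u_power 0 = \<one>\<^bsub>OU1\<^esub>"
  by (simp add: u_power_eq)

lemma star_u_power: "star OU1 (u_power n) = u_power (- n)"
  by (simp add: u_power_eq OU1.star_star_power)

definition int_monoid :: "int monoid" where
  "int_monoid = \<lparr>carrier = UNIV, mult = (+), one = 0\<rparr>"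

interpretation laurent: star_monoid int_monoid uminus
  by unfold_locales (auto simp: int_monoid_def)

text \<open>The homomorphism from \<open>\<complex>[u, u\<^sup>*]\<close> to the group algebra of the integers that sends \<open>u\<close> to the
  generator \<open>1\<close> makes the coefficient of \<open>u\<^sup>0\<close> well defined. In particular all other powers of
  \<open>u\<close> have constant term \<open>0\<close>.\<close>

lemma constant_term:
  obtains \<epsilon> where "\<And>y y'. \<lbrakk>y \<in> carrier OU1; y' \<in> carrier OU1\<rbrakk> \<Longrightarrow> \<epsilon> (y \<oplus>\<^bsub>OU1\<^esub> y') = (\<epsilon> y + \<epsilon> y' :: complex)"
    "\<And>c y. y \<in> carrier OU1 \<Longrightarrow> \<epsilon> (c \<odot>\<^bsub>OU1\<^esub> y) = c * \<epsilon> y"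
    "\<And>n. \<epsilon> (u_power n) = (if n = 0 then 1 else 0)"
proof -
  let ?L = "monoid_star_algebra int_monoid uminus"
  let ?x = "Poly_Mapping.single (1::int) (1::complex)"
  have x: "?x \<in> carrier ?L" by (rule laurent.single_carrier) (simp add: int_monoid_def)
  have mult: "Poly_Mapping.single m c \<otimes>\<^bsub>?L\<^esub> Poly_Mapping.single n d = Poly_Mapping.single (m + n) (c * d)" for m n c d
    by (simp only: laurent.mult_CM_single) (simp add: int_monoid_def)
  have one: "\<one>\<^bsub>?L\<^esub> = Poly_Mapping.single 0 1"
    by (simp only: laurent.one_CM) (simp add: int_monoid_def)
  have pow: "Poly_Mapping.single m 1 [^]\<^bsub>?L\<^esub> n = Poly_Mapping.single (int n * m) 1" for m :: int and n :: nat
    by (induction n) (simp_all add: one mult algebra_simps)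
  let ?h = "linear_extension ?L (word_value ?L (\<lambda>_::unit. ?x))"
  have h: "?h \<in> star_alg_hom free_star_algebra ?L" "?h (free_gen ()) = ?x"
    using laurent.CM.free_lift[of "\<lambda>_. ?x", OF x] by auto
  have hom: "star_hom free_star_algebra ?L ?h"
    by (intro star_homI word.CM.star_alg_axioms laurent.CM.star_alg_axioms h)
  have "?h r = \<zero>\<^bsub>?L\<^esub>" if "r \<in> U1_relations" for r
    using U1_relations_hom[OF hom] that unfolding h(2)
    by (simp add: laurent.star_CM_single mult one)
  then obtain \<psi> where \<psi>: "\<psi> \<in> star_alg_hom OU1 ?L" "\<psi> gen_u = ?x"
    using presented_lift[OF laurent.CM.star_alg_axioms h(1), of U1_relations] h(2)
    unfolding OU1_def gen_u_def presented_gen_def by metis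
  interpret \<psi>: star_hom OU1 ?L \<psi>
    by (intro star_homI OU1_star_alg laurent.CM.star_alg_axioms \<psi>)
  have \<psi>_u: "\<psi> (u_power n) = Poly_Mapping.single n 1" for n
    by (auto simp: u_power_eq \<psi>.star_power \<psi>(2) laurent.CM.star_power_def pow laurent.star_CM_single)
  show thesis
  proof (rule that[of "\<lambda>y. Poly_Mapping.lookup (\<psi> y) 0"])
    show "Poly_Mapping.lookup (\<psi> (y \<oplus>\<^bsub>OU1\<^esub> y')) 0 = Poly_Mapping.lookup (\<psi> y) 0 + Poly_Mapping.lookup (\<psi> y') 0"
      if "y \<in> carrier OU1" "y' \<in> carrier OU1" for y y'
      using that by (simp add: \<psi>.add laurent.add_CM lookup_add)
    show "Poly_Mapping.lookup (\<psi> (c \<odot>\<^bsub>OU1\<^esub> y)) 0 = c * Poly_Mapping.lookup (\<psi> y) 0" if "y \<in> carrier OU1" for c y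
      using that by (simp add: \<psi>.smult laurent.lookup_smult_CM)
    show "Poly_Mapping.lookup (\<psi> (u_power n)) 0 = (if n = 0 then 1 else 0)" for n
      by (simp add: \<psi>_u lookup_single when_def)
  qed
qed

section \<open>The coaction\<close>

context two_star_algs
begin

lemma pure_minus_left:
  "\<lbrakk>x \<in> carrier S; x' \<in> carrier S; y \<in> carrier T\<rbrakk> \<Longrightarrow> pure (x \<ominus>\<^bsub>S\<^esub> x') y = pure x y \<ominus>\<^bsub>ST\<^esub> pure x' y"
  by (simp add: S.minus_eq_smult ST.quot.T.minus_eq_smult pure_add_left pure_smult_left)

lemma pure_zero_left: "y \<in> carrier T \<Longrightarrow> pure \<zero>\<^bsub>S\<^esub> y = \<zero>\<^bsub>ST\<^esub>"
  using pure_smult_left[of "\<zero>\<^bsub>S\<^esub>" y 0] by simp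

text \<open>Each relation is homogeneous in \<open>a\<close> and in \<open>b\<close>, with adjoints counted negatively. As \<open>u\<close> and \<open>v\<close> are
  commuting unitaries, replacing \<open>a\<close> and \<open>b\<close> by \<open>a \<otimes> u\<close> and \<open>b \<otimes> v\<close> only puts a common factor on the
  right of the tensor sign.\<close>

lemma heegaard_pair_tensor:
  assumes "heegaard_pair S a p b q \<theta>"
    and u: "u \<in> carrier T" "u \<otimes>\<^bsub>T\<^esub> star T u = \<one>\<^bsub>T\<^esub>" "star T u \<otimes>\<^bsub>T\<^esub> u = \<one>\<^bsub>T\<^esub>"
    and v: "v \<in> carrier T" "v \<otimes>\<^bsub>T\<^esub> star T v = \<one>\<^bsub>T\<^esub>" "star T v \<otimes>\<^bsub>T\<^esub> v = \<one>\<^bsub>T\<^esub>"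
    and uv: "v \<otimes>\<^bsub>T\<^esub> u = u \<otimes>\<^bsub>T\<^esub> v" "star T v \<otimes>\<^bsub>T\<^esub> u = u \<otimes>\<^bsub>T\<^esub> star T v"
  shows "heegaard_pair ST (pure a u) p (pure b v) q \<theta>"
proof -
  interpret P: heegaard_pair S a p b q \<theta> by fact
  note simps = pure_mult pure_star pure_one pure_minus_left pure_smult_left
  have c: "a \<in> carrier S" "b \<in> carrier S" by auto
  have commute: "(pure a u \<otimes>\<^bsub>ST\<^esub> pure b v) \<ominus>\<^bsub>ST\<^esub> (c \<odot>\<^bsub>ST\<^esub> (pure b v \<otimes>\<^bsub>ST\<^esub> pure a u)) =
      pure ((a \<otimes>\<^bsub>S\<^esub> b) \<ominus>\<^bsub>S\<^esub> (c \<odot>\<^bsub>S\<^esub> (b \<otimes>\<^bsub>S\<^esub> a))) (u \<otimes>\<^bsub>T\<^esub> v)"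
    "(pure a u \<otimes>\<^bsub>ST\<^esub> star ST (pure b v)) \<ominus>\<^bsub>ST\<^esub> (c \<odot>\<^bsub>ST\<^esub> (star ST (pure b v) \<otimes>\<^bsub>ST\<^esub> pure a u)) =
      pure ((a \<otimes>\<^bsub>S\<^esub> star S b) \<ominus>\<^bsub>S\<^esub> (c \<odot>\<^bsub>S\<^esub> (star S b \<otimes>\<^bsub>S\<^esub> a))) (u \<otimes>\<^bsub>T\<^esub> star T v)" for c
    using c u(1) v(1) by (simp_all add: simps uv)
  have disc: "((star ST (pure x w) \<otimes>\<^bsub>ST\<^esub> pure x w) \<ominus>\<^bsub>ST\<^esub> (c \<odot>\<^bsub>ST\<^esub> (pure x w \<otimes>\<^bsub>ST\<^esub> star ST (pure x w))))
        \<ominus>\<^bsub>ST\<^esub> (d \<odot>\<^bsub>ST\<^esub> \<one>\<^bsub>ST\<^esub>) =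
      pure (((star S x \<otimes>\<^bsub>S\<^esub> x) \<ominus>\<^bsub>S\<^esub> (c \<odot>\<^bsub>S\<^esub> (x \<otimes>\<^bsub>S\<^esub> star S x))) \<ominus>\<^bsub>S\<^esub> (d \<odot>\<^bsub>S\<^esub> \<one>\<^bsub>S\<^esub>)) \<one>\<^bsub>T\<^esub>"
    and defect: "\<one>\<^bsub>ST\<^esub> \<ominus>\<^bsub>ST\<^esub> (pure x w \<otimes>\<^bsub>ST\<^esub> star ST (pure x w)) = pure (\<one>\<^bsub>S\<^esub> \<ominus>\<^bsub>S\<^esub> (x \<otimes>\<^bsub>S\<^esub> star S x)) \<one>\<^bsub>T\<^esub>"
    if "x \<in> carrier S" "w \<in> carrier T" "w \<otimes>\<^bsub>T\<^esub> star T w = \<one>\<^bsub>T\<^esub>" "star T w \<otimes>\<^bsub>T\<^esub> w = \<one>\<^bsub>T\<^esub>" for x w c d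
    using that by (simp_all add: simps)
  show ?thesis
    unfolding heegaard_pair_def heegaard_pair_axioms_def quantum_disc_def quantum_disc_axioms_def
      commute disc[OF c(1) u] disc[OF c(2) v] defect[OF c(1) u] defect[OF c(2) v]
    using c u(1) v(1)
    by (simp only: P.A.disc_relation P.B.disc_relation P.ab_relation P.ab_star_relation P.A.r_pos P.B.r_pos
        pure_zero_left pure_mult pure_closed P.AB_relation S.minus_closed S.one_closed T.one_closed
        S.m_closed S.star_closed T.m_closed T.star_closed T.r_one ST.quot.T.star_alg_axioms simp_thms)
qed

lemma pure_one_hom: "(\<lambda>x. pure x \<one>\<^bsub>T\<^esub>) \<in> star_alg_hom S ST"
  by (rule star_alg_homI) (simp_all add: pure_mult pure_star pure_one pure_add_left pure_smult_left)

end

section \<open>The coinvariants\<close>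

locale weighted_coaction_setting =
  fixes p q \<theta> :: real and k l :: int
  assumes p: "p > 0" and q: "q > 0" and k: "k > 0" and kl: "coprime k l"
begin

abbreviation "SS \<equiv> OS3 p q \<theta>"
abbreviation "a \<equiv> gen_a p q \<theta>"
abbreviation "b \<equiv> gen_b p q \<theta>"

sublocale S3: heegaard_pair SS a p b q \<theta> by (rule OS3_heegaard_pair[OF p q])
sublocale SU: two_star_algs SS OU1
  by (simp add: two_star_algs_def S3.star_alg_axioms OU1.star_alg_axioms)

abbreviation \<phi> where "\<phi> \<equiv> weighted_coaction p q \<theta> k l"

lemma generated_by_gens:
  assumes "star_subalgebra H SS" "a \<in> H" "b \<in> H"
  shows "H = carrier SS"
proof -
  have "presented_gen (S3_relations p q \<theta>) g \<in> H" for g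
    using assms(2,3) by (cases g) (auto simp: gen_a_def gen_b_def)
  then show ?thesis using presented_generated assms(1) unfolding OS3_def by blast
qed

text \<open>Existence and uniqueness together identify the definite description that defines the coaction.\<close>

lemma coaction:
  shows coaction_hom: "\<phi> \<in> star_alg_hom SS SU.ST"
    and coaction_a: "\<phi> a = SU.pure a (u_power k)"
    and coaction_b: "\<phi> b = SU.pure b (u_power l)"
proof -
  let ?P = "\<lambda>\<phi>. \<phi> \<in> star_alg_hom SS SU.ST \<and> \<phi> \<in> extensional (carrier SS) \<and>
       \<phi> a = SU.pure a (u_power k) \<and> \<phi> b = SU.pure b (u_power l)"
  have "heegaard_pair SU.ST (SU.pure a (u_power k)) p (SU.pure b (u_power l)) q \<theta>"
    by (rule SU.heegaard_pair_tensor[OF S3.heegaard_pair_axioms])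
      (simp_all add: star_u_power u_power_add[symmetric] u_power_0 add.commute)
  then obtain g where g: "g \<in> star_alg_hom SS SU.ST" "g a = SU.pure a (u_power k)" "g b = SU.pure b (u_power l)"
    by (rule OS3_lift[OF p q])
  interpret g: star_hom SS SU.ST g
    by (intro star_homI S3.star_alg_axioms SU.ST.quot.T.star_alg_axioms g)
  have "restrict g (carrier SS) \<in> star_alg_hom SS SU.ST"
    by (rule star_alg_homI) (simp_all add: g.homs)
  then have ex: "?P (restrict g (carrier SS))" by (simp add: g)
  have unique: "\<phi>1 = \<phi>2" if 1: "?P \<phi>1" and 2: "?P \<phi>2" for \<phi>1 \<phi>2
  proof -
    interpret \<phi>1: star_hom SS SU.ST \<phi>1
      using 1 by (intro star_homI S3.star_alg_axioms SU.ST.quot.T.star_alg_axioms) blast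
    have "{x \<in> carrier SS. \<phi>1 x = \<phi>2 x} = carrier SS"
      using 1 2 \<phi>1.equalizer_star_subalgebra[of \<phi>2] by (intro generated_by_gens) auto
    then show ?thesis using 1 2 by (intro extensionalityI[of \<phi>1 "carrier SS" \<phi>2]) auto
  qed
  have "?P (THE \<phi>. ?P \<phi>)" by (rule theI[where P = ?P, OF ex unique[OF _ ex]])
  then have "?P \<phi>" unfolding weighted_coaction_def .
  then show "\<phi> \<in> star_alg_hom SS SU.ST" "\<phi> a = SU.pure a (u_power k)" "\<phi> b = SU.pure b (u_power l)"
    by blast+
qed

sublocale coact: star_hom SS SU.ST \<phi>
  by (intro star_homI S3.star_alg_axioms SU.ST.quot.T.star_alg_axioms coaction_hom)

definition homogeneous where
  "homogeneous x n \<longleftrightarrow> x \<in> carrier SS \<and> \<phi> x = SU.pure x (u_power n)"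

lemma homogeneous_mult: "homogeneous x m \<Longrightarrow> homogeneous y n \<Longrightarrow> homogeneous (x \<otimes>\<^bsub>SS\<^esub> y) (m + n)"
  by (simp add: homogeneous_def coact.mult SU.pure_mult u_power_add)

lemma homogeneous_star: "homogeneous x m \<Longrightarrow> homogeneous (star SS x) (- m)"
  by (simp add: homogeneous_def coact.star SU.pure_star star_u_power)

lemma homogeneous_one: "homogeneous \<one>\<^bsub>SS\<^esub> 0"
  by (simp add: homogeneous_def coact.one SU.pure_one u_power_0)

lemma homogeneous_gens: "homogeneous a k" "homogeneous b l"
  by (simp_all add: homogeneous_def coaction_a coaction_b)

lemma homogeneous_pow:
  assumes "homogeneous x m"
  shows "homogeneous (x [^]\<^bsub>SS\<^esub> n) (int n * m)"
proof (induction n)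
  case (Suc n)
  from homogeneous_mult[OF this assms] show ?case by (simp add: algebra_simps)
qed (simp add: homogeneous_one)

lemma homogeneous_star_power: "homogeneous x m \<Longrightarrow> homogeneous (S3.star_power x n) (n * m)"
  using homogeneous_pow[of x m "nat n"] homogeneous_pow[OF homogeneous_star, of x m "nat \<bar>n\<bar>"]
  by (cases "n \<ge> 0") (simp_all add: S3.star_power_def)

lemma coinvariant_iff: "x \<in> heegaard_sphere p q \<theta> k l \<longleftrightarrow> homogeneous x 0"
  by (simp add: heegaard_sphere_def homogeneous_def u_power_0)

lemma homogeneous_word:
  "homogeneous (word_value SS S3.letter w) (k * degree_in GenA w + l * degree_in GenB w)"
proof (induction w)
  case Nil
  show ?case by (simp add: word_value_def homogeneous_one)
next
  case (Cons x w)
  obtain g adj where x: "x = (g, adj)" by force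
  define s where "s = (k * degree_in GenA [x] + l * degree_in GenB [x])"
  have "homogeneous (if adj then star SS (S3.letter g) else S3.letter g) s"
    using homogeneous_gens homogeneous_star by (cases g; cases adj) (auto simp: x s_def)
  from homogeneous_mult[OF this Cons] show ?case
    by (simp add: x word_value_def s_def algebra_simps)
qed

lemma word_eq: "presented_word (S3_relations p q \<theta>) w = word_value SS S3.letter w"
proof (induction w)
  case Nil
  show ?case by (simp add: presented_word_Nil word_value_def OS3_def)
next
  case (Cons x w)
  obtain g adj where x: "x = (g, adj)" by force
  have "presented_gen (S3_relations p q \<theta>) g = S3.letter g"
    by (cases g) (simp_all add: gen_a_def gen_b_def)
  then show ?case using Cons by (simp add: x presented_word_Cons word_value_def OS3_def)
qed

abbreviation "G \<equiv> generated_star_subalgebra SS {S3.A.Z, S3.B.Z, S3.C k l}"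

lemma G: "star_subalgebra G SS"
  by (rule S3.generated_star_subalgebra_is_star_subalgebra) auto

lemma coinvariants_star_subalgebra: "star_subalgebra (heegaard_sphere p q \<theta> k l) SS"
  using coact.equalizer_star_subalgebra[OF SU.pure_one_hom] by (simp add: heegaard_sphere_def)

text \<open>The elements \<open>aa\<^sup>*\<close> and \<open>bb\<^sup>*\<close> have degree \<open>0\<close>, and \<open>C\<close> has degree \<open>kl - lk\<close>.\<close>

lemma generated_subset_coinvariants: "G \<subseteq> heegaard_sphere p q \<theta> k l"
proof (rule generated_star_subalgebra_minimal[OF coinvariants_star_subalgebra])
  note H = coinvariants_star_subalgebra
  have "homogeneous (a \<otimes>\<^bsub>SS\<^esub> star SS a) 0" "homogeneous (b \<otimes>\<^bsub>SS\<^esub> star SS b) 0"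
    using homogeneous_mult[OF homogeneous_gens(1) homogeneous_star[OF homogeneous_gens(1)]]
      homogeneous_mult[OF homogeneous_gens(2) homogeneous_star[OF homogeneous_gens(2)]] by auto
  then have "S3.A.Z \<in> heegaard_sphere p q \<theta> k l" "S3.B.Z \<in> heegaard_sphere p q \<theta> k l"
    unfolding S3.A.Z_def S3.B.Z_def
    by (intro S3.star_subalgebra_minus[OF H]; simp add: coinvariant_iff homogeneous_one)+
  moreover have "homogeneous (S3.C k l) (l * k + (- k) * l)"
    unfolding S3.C_def by (intro homogeneous_mult homogeneous_star_power homogeneous_gens)
  ultimately show "{S3.A.Z, S3.B.Z, S3.C k l} \<subseteq> heegaard_sphere p q \<theta> k l"
    by (simp add: coinvariant_iff)
qed

text \<open>The linear map \<open>L\<close> recovers a coinvariant \<open>x\<close> from \<open>\<phi> x = x \<otimes> 1\<close>, and it maps the image of any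
  word into the generated subalgebra: to the word itself if it has degree \<open>0\<close>, and to \<open>0\<close> otherwise.\<close>

lemma coinvariants_subset_generated: "heegaard_sphere p q \<theta> k l \<subseteq> G"
proof
  note G_closed = star_subalgebraD[OF G]
  obtain \<epsilon> where \<epsilon>: "\<And>y y'. \<lbrakk>y \<in> carrier OU1; y' \<in> carrier OU1\<rbrakk> \<Longrightarrow> \<epsilon> (y \<oplus>\<^bsub>OU1\<^esub> y') = (\<epsilon> y + \<epsilon> y' :: complex)"
    "\<And>c y. y \<in> carrier OU1 \<Longrightarrow> \<epsilon> (c \<odot>\<^bsub>OU1\<^esub> y) = c * \<epsilon> y"
    "\<And>n. \<epsilon> (u_power n) = (if n = 0 then 1 else 0)"
    by (rule constant_term) blast
  obtain L where L: "\<And>x y. \<lbrakk>x \<in> carrier SS; y \<in> carrier OU1\<rbrakk> \<Longrightarrow> L (SU.pure x y) = \<epsilon> y \<odot>\<^bsub>SS\<^esub> x"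
    "\<And>s t. \<lbrakk>s \<in> carrier SU.ST; t \<in> carrier SU.ST\<rbrakk> \<Longrightarrow> L (s \<oplus>\<^bsub>SU.ST\<^esub> t) = L s \<oplus>\<^bsub>SS\<^esub> L t"
    "\<And>c s. s \<in> carrier SU.ST \<Longrightarrow> L (c \<odot>\<^bsub>SU.ST\<^esub> s) = c \<odot>\<^bsub>SS\<^esub> L s"
    by (rule SU.tensor_lift[of SS "\<lambda>x y. \<epsilon> y \<odot>\<^bsub>SS\<^esub> x"])
      (auto simp: S3.star_alg_axioms \<epsilon> S3.smult_l_distr S3.smult_r_distr S3.smult_smult mult.commute)
  have proj: "L (\<phi> x) = (if n = 0 then x else \<zero>\<^bsub>SS\<^esub>)" if "homogeneous x n" for x n
    using that by (auto simp: homogeneous_def L \<epsilon>)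
  have word: "L (\<phi> (word_value SS S3.letter w)) \<in> G" for w
    using proj[OF homogeneous_word[of w]] S3.degree_zero_word_in_generated[OF k kl, of w] G_closed(7)
    by auto
  fix x assume x: "x \<in> heegaard_sphere p q \<theta> k l"
  then have "x \<in> carrier (presented_star_algebra (S3_relations p q \<theta>))"
    by (simp add: coinvariant_iff homogeneous_def OS3_def)
  then have "L (\<phi> x) \<in> G"
  proof (induction x rule: presented_induct)
    case (smult_word c w)
    have "word_value SS S3.letter w \<in> carrier SS" using homogeneous_word by (simp add: homogeneous_def)
    then show ?case using word[of w] G_closed(5)
      by (simp add: word_eq OS3_def[symmetric] coact.smult L(3))
  next
    case (add x y)
    then show ?case using G_closed(3) by (simp add: OS3_def[symmetric] coact.add L(2))
  qed
  moreover have "L (\<phi> x) = x" using proj x by (simp add: coinvariant_iff)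
  ultimately show "x \<in> G" by simp
qed

lemma coinvariants_eq: "heegaard_sphere p q \<theta> k l = G"
  using generated_subset_coinvariants coinvariants_subset_generated by blast

end

theorem theorem2p2:
  fixes p q \<theta> :: real and k l :: int
  assumes "0 < p" "p < 1" "0 < q" "q < 1" "0 < \<theta>" "\<theta> < 1" "\<theta> \<notin> \<rat>"
    and "k > 0" "l \<noteq> 0" "coprime k l"
  shows
    "let S = OS3 p q \<theta>; a = gen_a p q \<theta>; b = gen_b p q \<theta>;
         A = \<one>\<^bsub>S\<^esub> \<ominus>\<^bsub>S\<^esub> (a \<otimes>\<^bsub>S\<^esub> star S a);
         B = \<one>\<^bsub>S\<^esub> \<ominus>\<^bsub>S\<^esub> (b \<otimes>\<^bsub>S\<^esub> star S b);
         fA = (\<lambda>n. \<one>\<^bsub>S\<^esub> \<ominus>\<^bsub>S\<^esub> (complex_of_real (p powi n) \<odot>\<^bsub>S\<^esub> A));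
         fB = (\<lambda>n. \<one>\<^bsub>S\<^esub> \<ominus>\<^bsub>S\<^esub> (complex_of_real (q powi n) \<odot>\<^bsub>S\<^esub> B))
     in
     (l > 0 \<longrightarrow>
       (let C = (a [^]\<^bsub>S\<^esub> nat l) \<otimes>\<^bsub>S\<^esub> (star S b [^]\<^bsub>S\<^esub> nat k);
            P1 = ordered_prod S (\<lambda>i. fA (int i)) (nat l);
            Q1 = ordered_prod S (\<lambda>j. fB (int j - k)) (nat k);
            P2 = ordered_prod S (\<lambda>i. fA (int i - l)) (nat l);
            Q2 = ordered_prod S (\<lambda>j. fB (int j)) (nat k)
        in heegaard_sphere p q \<theta> k l = generated_star_subalgebra S {A, B, C} \<and>
           star S A = A \<and> star S B = B \<and>
           A \<otimes>\<^bsub>S\<^esub> B = \<zero>\<^bsub>S\<^esub> \<and> B \<otimes>\<^bsub>S\<^esub> A = \<zero>\<^bsub>S\<^esub> \<and>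
           A \<otimes>\<^bsub>S\<^esub> C = complex_of_real (p powi l) \<odot>\<^bsub>S\<^esub> (C \<otimes>\<^bsub>S\<^esub> A) \<and>
           B \<otimes>\<^bsub>S\<^esub> C = complex_of_real (q powi (- k)) \<odot>\<^bsub>S\<^esub> (C \<otimes>\<^bsub>S\<^esub> B) \<and>
           star S C \<otimes>\<^bsub>S\<^esub> C = P1 \<otimes>\<^bsub>S\<^esub> Q1 \<and>
           C \<otimes>\<^bsub>S\<^esub> star S C = P2 \<otimes>\<^bsub>S\<^esub> Q2 \<and>
           star S C \<otimes>\<^bsub>S\<^esub> C = (P1 \<oplus>\<^bsub>S\<^esub> Q1) \<ominus>\<^bsub>S\<^esub> \<one>\<^bsub>S\<^esub> \<and>
           C \<otimes>\<^bsub>S\<^esub> star S C = (P2 \<oplus>\<^bsub>S\<^esub> Q2) \<ominus>\<^bsub>S\<^esub> \<one>\<^bsub>S\<^esub>)) \<and>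
     (l < 0 \<longrightarrow>
       (let C = (star S a [^]\<^bsub>S\<^esub> nat \<bar>l\<bar>) \<otimes>\<^bsub>S\<^esub> (star S b [^]\<^bsub>S\<^esub> nat k);
            P1 = ordered_prod S (\<lambda>i. fA (int i + l)) (nat \<bar>l\<bar>);
            Q1 = ordered_prod S (\<lambda>j. fB (int j - k)) (nat k);
            P2 = ordered_prod S (\<lambda>i. fA (int i)) (nat \<bar>l\<bar>);
            Q2 = ordered_prod S (\<lambda>j. fB (int j)) (nat k)
        in heegaard_sphere p q \<theta> k l = generated_star_subalgebra S {A, B, C} \<and>
           star S A = A \<and> star S B = B \<and>
           A \<otimes>\<^bsub>S\<^esub> B = \<zero>\<^bsub>S\<^esub> \<and> B \<otimes>\<^bsub>S\<^esub> A = \<zero>\<^bsub>S\<^esub> \<and>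
           A \<otimes>\<^bsub>S\<^esub> C = complex_of_real (p powi l) \<odot>\<^bsub>S\<^esub> (C \<otimes>\<^bsub>S\<^esub> A) \<and>
           B \<otimes>\<^bsub>S\<^esub> C = complex_of_real (q powi (- k)) \<odot>\<^bsub>S\<^esub> (C \<otimes>\<^bsub>S\<^esub> B) \<and>
           star S C \<otimes>\<^bsub>S\<^esub> C = P1 \<otimes>\<^bsub>S\<^esub> Q1 \<and>
           C \<otimes>\<^bsub>S\<^esub> star S C = P2 \<otimes>\<^bsub>S\<^esub> Q2 \<and>
           star S C \<otimes>\<^bsub>S\<^esub> C = (P1 \<oplus>\<^bsub>S\<^esub> Q1) \<ominus>\<^bsub>S\<^esub> \<one>\<^bsub>S\<^esub> \<and>
           C \<otimes>\<^bsub>S\<^esub> star S C = (P2 \<oplus>\<^bsub>S\<^esub> Q2) \<ominus>\<^bsub>S\<^esub> \<one>\<^bsub>S\<^esub>))"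
proof -
  interpret weighted_coaction_setting p q \<theta> k l by unfold_locales fact+
  have C_eq:
    "l > 0 \<Longrightarrow> (a [^]\<^bsub>SS\<^esub> nat l) \<otimes>\<^bsub>SS\<^esub> (star SS b [^]\<^bsub>SS\<^esub> nat k) = S3.C k l"
    "l < 0 \<Longrightarrow> (star SS a [^]\<^bsub>SS\<^esub> nat \<bar>l\<bar>) \<otimes>\<^bsub>SS\<^esub> (star SS b [^]\<^bsub>SS\<^esub> nat k) = S3.C k l"
    using k by (simp_all add: S3.C_def S3.star_power_def)
  have star_products:
    "l > 0 \<Longrightarrow> star SS (S3.C k l) \<otimes>\<^bsub>SS\<^esub> S3.C k l =
      ordered_prod SS (\<lambda>i. S3.A.factor (int i)) (nat l) \<otimes>\<^bsub>SS\<^esub> ordered_prod SS (\<lambda>j. S3.B.factor (int j - k)) (nat k)"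
    "l > 0 \<Longrightarrow> S3.C k l \<otimes>\<^bsub>SS\<^esub> star SS (S3.C k l) =
      ordered_prod SS (\<lambda>i. S3.A.factor (int i - l)) (nat l) \<otimes>\<^bsub>SS\<^esub> ordered_prod SS (\<lambda>j. S3.B.factor (int j)) (nat k)"
    "l < 0 \<Longrightarrow> star SS (S3.C k l) \<otimes>\<^bsub>SS\<^esub> S3.C k l =
      ordered_prod SS (\<lambda>i. S3.A.factor (int i + l)) (nat \<bar>l\<bar>) \<otimes>\<^bsub>SS\<^esub> ordered_prod SS (\<lambda>j. S3.B.factor (int j - k)) (nat k)"
    "l < 0 \<Longrightarrow> S3.C k l \<otimes>\<^bsub>SS\<^esub> star SS (S3.C k l) =
      ordered_prod SS (\<lambda>i. S3.A.factor (int i)) (nat \<bar>l\<bar>) \<otimes>\<^bsub>SS\<^esub> ordered_prod SS (\<lambda>j. S3.B.factor (int j)) (nat k)"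
    by (intro S3.star_C_mult_C S3.C_mult_star_C S3.star_X_mult_X k; simp)+
  show ?thesis
    unfolding Let_def S3.A.Z_def[symmetric] S3.B.Z_def[symmetric]
      S3.A.factor_def[symmetric] S3.B.factor_def[symmetric]
    using star_products C_eq coinvariants_eq S3.AB S3.BA S3.AC S3.BC by (simp add: S3.product_AB)
qed

end
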